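(* Let $A$ be an $n$-by-$n$ normal complex matrix and let $k=\dim\ker A$. Then $k\le d(A)\le\lfloor (n+k)/2\rfloor$. Moreover, let $\lambda_1,\ldots,\lambda_{n-k}$ be the nonzero eigenvalues of $A$ (counting multiplicity) arranged such that $\arg\lambda_1\le\cdots\le\arg\lambda_{n-k}$. Then: (a) $d(A)=k$ if and only if $0$ is not in the convex hull of $\{\lambda_1,\ldots,\lambda_{n-k}\}$. (b) If $n-k$ is even, then $d(A)=\lfloor (n+k)/2\rfloor$ if and only if $\arg\lambda_{j+((n-k)/2)}-\arg\lambda_j=\pi$ for all $j$ with $1\le j\le (n-k)/2$. If $n-k$ is odd, then $d(A)=\lfloor (n+k)/2\rfloor$ if and only if $\arg\lambda_{j+((n-k-1)/2)}-\arg\lambda_j\le\pi$ for all $j$ with $1\le j\le (n-k+1)/2$ and $\arg\lambda_{j-((n-k+1)/2)}-\arg\lambda_j\le-\pi$ for all $j$ with $(n-k+3)/2\le j\le n-k$.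
   Context: For an $n$-by-$n$ complex matrix $A$, the zero-dilation index $d(A)$ is the largest integer $k\ge 1$ such that there is an $n$-by-$k$ complex matrix $V$ with $V^*V=I_k$ and $V^*AV=0_k$, where $0_k$ is the $k$-by-$k$ zero matrix; if no such $k$ exists, $d(A)=0$. For a nonzero complex number $z$, $\arg z$ is the unique number $\theta\in[0,2\pi)$ with $z=|z|e^{i\theta}$. The convex hull of the empty set is empty. *)

theory Defs
  imports
    "Jordan_Normal_Form.Schur_Decomposition"
    "Jordan_Normal_Form.Matrix_Kernel"
    "HOL-Analysis.Complex_Transcendental"
begin

definition normal_mat :: "complex mat \<Rightarrow> bool" where
  "normal_mat A \<longleftrightarrow> square_mat A \<and> mat_adjoint A * A = A * mat_adjoint A"

definition is_zero_dilation :: "complex mat \<Rightarrow> nat \<Rightarrow> bool" where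
  "is_zero_dilation A k \<longleftrightarrow>
    (\<exists>V \<in> carrier_mat (dim_row A) k.
      mat_adjoint V * V = 1\<^sub>m k \<and> mat_adjoint V * A * V = 0\<^sub>m k k)"

(* The isometry condition forces k \<le> dim_row A, so GREATEST ranges over a bounded set. *)
definition zero_dilation_index :: "complex mat \<Rightarrow> nat" where
  "zero_dilation_index A =
    (if \<exists>k\<ge>1. is_zero_dilation A k then (GREATEST k. k \<ge> 1 \<and> is_zero_dilation A k) else 0)"

(* Multiplicities are algebraic, i.e. orders as roots of the characteristic polynomial. *)
definition nonzero_eigenvalues :: "complex mat \<Rightarrow> complex multiset" where
  "nonzero_eigenvalues A = {#z \<in># proots (char_poly A). z \<noteq> 0#}"

end

theory Submission
  imports Defs "Jordan_Normal_Form.Jordan_Normal_Form_Uniqueness"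
begin

text \<open>
  After a unitary diagonalization, a zero dilation of size \<open>r\<close> is an \<open>r\<close>-dimensional subspace on
  which \<open>\<Sum> d\<^sub>j |x\<^sub>j|\<^sup>2\<close> vanishes, where the \<open>d\<^sub>j\<close> are the eigenvalues. Such a subspace meets the
  span of the eigenvectors whose eigenvalues lie in an open half-plane bounded by a line through \<open>0\<close>
  only in \<open>0\<close>, so every such half-plane contains at most \<open>n - r\<close> eigenvalues. This yields all
  upper bounds and translates into the conditions on the gaps between the arguments.

  Conversely, isotropic subspaces supported on disjoint sets of eigenvalues add up. A zero
  eigenvalue, an opposite pair, or a set with \<open>0\<close> in its convex hull contributes a dimension.
  In the odd case one removes opposite pairs until every line through \<open>0\<close> and one of the \<open>2p + 1\<close>
  remaining eigenvalues has \<open>p\<close> eigenvalues strictly on each side. Rescaling the eigenvectors changes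
  the moduli of the eigenvalues arbitrarily, and for suitable moduli Lagrange interpolation shows
  that the values at the eigenvalues of the binary forms of degree \<open>p - 1\<close> form an isotropic subspace.
\<close>

section \<open>Unitary diagonalization of normal matrices\<close>

lemma mat_adjoint_dim [simp]:
  "dim_row (mat_adjoint A) = dim_col A" "dim_col (mat_adjoint A) = dim_row A"
  by (simp_all add: mat_adjoint_def)

lemma mat_adjoint_carrier [simp]: "A \<in> carrier_mat n m \<Longrightarrow> mat_adjoint A \<in> carrier_mat m n"
  unfolding carrier_mat_def by simp

lemma mat_adjoint_index [simp]:
  "i < dim_col A \<Longrightarrow> j < dim_row A \<Longrightarrow> mat_adjoint A $$ (i, j) = conjugate (A $$ (j, i))"
  by (simp add: mat_adjoint_def mat_of_rows_index)

lemma index_mult_mat_sum: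
  "i < dim_row A \<Longrightarrow> j < dim_col B \<Longrightarrow> dim_row B = dim_col A \<Longrightarrow>
    (A * B) $$ (i, j) = (\<Sum>l<dim_col A. A $$ (i, l) * B $$ (l, j))"
  by (simp add: scalar_prod_def lessThan_atLeast0)

lemma mat_adjoint_mult:
  fixes A B :: "complex mat"
  assumes "dim_col A = dim_row B"
  shows "mat_adjoint (A * B) = mat_adjoint B * mat_adjoint A"
  by (rule eq_matI) (use assms in \<open>auto simp: index_mult_mat_sum mult.commute simp del: index_mult_mat(1)\<close>)

lemma mat_adjoint_adjoint [simp]: "mat_adjoint (mat_adjoint (A :: complex mat)) = A"
  by (rule eq_matI) auto

text \<open>Gram-Schmidt on a basis completion of \<open>v\<close> keeps the head of the list, so
  normalizing the resulting columns changes \<open>v\<close> only by a scalar.\<close>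

lemma unitary_with_first_column:
  fixes v :: "complex Matrix.vec"
  assumes v: "v \<in> carrier_vec n" "v \<noteq> 0\<^sub>v n"
  shows "\<exists>W\<in>carrier_mat n n. mat_adjoint W * W = 1\<^sub>m n \<and> (\<exists>c. col W 0 = c \<cdot>\<^sub>v v)"
proof -
  interpret cof_vec_space n "TYPE(complex)" .
  define b where "b = basis_completion v"
  define ws where "ws = gram_schmidt n b"
  from basis_completion[OF v, folded b_def]
  have dist_b: "distinct b" and indep: "\<not> lin_dep (set b)" and b: "set b \<subseteq> carrier_vec n" 
    and hdb: "hd b = v" and len_b: "length b = n" by auto
  from gram_schmidt_result[OF b dist_b indep refl, folded ws_def]
  have ws: "set ws \<subseteq> carrier_vec n" "corthogonal ws" "length ws = n" 
    by (auto simp: len_b)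
  have n: "n > 0" using v by (cases n) auto
  from len_b n hdb obtain vs where bv: "b = v # vs" by (cases b) auto
  from gram_schmidt_hd[OF v(1), of vs, folded bv] have hdws: "hd ws = v" unfolding ws_def .
  have wsi [simp]: "ws ! i \<in> carrier_vec n" if "i < n" for i using ws that by auto
  have orth: "(\<Sum>l<n. cnj (ws ! i $ l) * ws ! j $ l) = 0" if "i < n" "j < n" "i \<noteq> j" for i j
  proof -
    have "ws ! j \<bullet>c ws ! i = 0" using corthogonalD[OF ws(2), of j i] ws(3) that by auto
    moreover have "dim_vec (ws ! i) = n" using wsi[OF that(1)] by (simp only: carrier_vec_def mem_Collect_eq)
    ultimately show ?thesis using that
      by (simp add: scalar_prod_def lessThan_atLeast0 mult.commute)
  qed
  define s where "s i = (\<Sum>l<n. (cmod (ws ! i $ l))\<^sup>2)" for i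
  have s: "s i > 0" if "i < n" for i
  proof -
    have "s i \<noteq> 0"
    proof
      assume *: "s i = 0"
      have z: "\<forall>l\<in>{..<n}. (cmod (ws ! i $ l))\<^sup>2 = 0" 
        using * unfolding s_def by (subst (asm) sum_nonneg_eq_0_iff) auto
      have "dim_vec (ws ! i) = n" using wsi[OF that(1)] by (simp only: carrier_vec_def mem_Collect_eq)
      hence "ws ! i \<bullet>c ws ! i = 0" using z by (auto simp: scalar_prod_def)
      thus False using corthogonalD[OF ws(2), of i i] ws(3) that by auto
    qed
    moreover have "s i \<ge> 0" unfolding s_def by (intro sum_nonneg) auto
    ultimately show ?thesis by simp
  qed
  have diag: "(\<Sum>l<n. cnj (ws ! i $ l) * ws ! i $ l) = of_real (s i)" for i
    unfolding s_def by (simp add: complex_norm_square mult.commute del: of_real_power)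
  define W where "W = Matrix.mat n n (\<lambda>(l, i). ws ! i $ l / of_real (sqrt (s i)))"
  have "mat_adjoint W * W = 1\<^sub>m n"
  proof (rule eq_matI)
    fix i j assume "i < dim_row (1\<^sub>m n :: complex mat)" "j < dim_col (1\<^sub>m n :: complex mat)"
    hence ij: "i < n" "j < n" by auto
    have "(mat_adjoint W * W) $$ (i, j) 
      = (\<Sum>l<n. (cnj (ws ! i $ l) * ws ! j $ l) / (of_real (sqrt (s i)) * of_real (sqrt (s j))))"
      using ij by (subst index_mult_mat_sum) (auto simp: W_def)
    also have "\<dots> = (\<Sum>l<n. cnj (ws ! i $ l) * ws ! j $ l) / (of_real (sqrt (s i)) * of_real (sqrt (s j)))"
      by (simp add: sum_divide_distrib)
    also have "\<dots> = 1\<^sub>m n $$ (i, j)"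
    proof (cases "i = j")
      case True
      have "complex_of_real (sqrt (s i)) * of_real (sqrt (s i)) = of_real (s i)"
        using s[of i] ij by (simp flip: of_real_mult)
      thus ?thesis using True s[of i] ij by (simp add: diag)
    qed (use ij orth in simp)
    finally show "(mat_adjoint W * W) $$ (i, j) = 1\<^sub>m n $$ (i, j)" .
  qed (auto simp: W_def)
  moreover have "col W 0 = (1 / of_real (sqrt (s 0))) \<cdot>\<^sub>v v"
  proof -
    have "ws ! 0 = v" using hdws ws(3) n by (metis hd_conv_nth length_greater_0_conv)
    moreover have "dim_vec v = n" using v by simp
    ultimately show ?thesis using n by (intro eq_vecI) (auto simp: W_def)
  qed
  moreover have "W \<in> carrier_mat n n" unfolding W_def by simp
  ultimately show ?thesis by blast
qed

lemma mult_carrier_square: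
  "X \<in> carrier_mat n n \<Longrightarrow> Y \<in> carrier_mat n n \<Longrightarrow> X * Y \<in> carrier_mat n n"
  by simp

lemmas square_assoc = mult_carrier_square assoc_mult_mat[of _ n n _ n _ n for n]

lemma unitary_inverse:
  fixes W :: "complex mat"
  assumes "W \<in> carrier_mat n n" "mat_adjoint W * W = 1\<^sub>m n"
  shows "W * mat_adjoint W = 1\<^sub>m n"
  using mat_mult_left_right_inverse[of "mat_adjoint W" n W] assms by simp

lemma four_block_diag_mult:
  fixes A :: "complex mat"
  assumes "A \<in> carrier_mat a a" "D \<in> carrier_mat d d" "A' \<in> carrier_mat a a" "D' \<in> carrier_mat d d"
  shows "four_block_mat A (0\<^sub>m a d) (0\<^sub>m d a) D * four_block_mat A' (0\<^sub>m a d) (0\<^sub>m d a) D'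
    = four_block_mat (A * A') (0\<^sub>m a d) (0\<^sub>m d a) (D * D')"
  using assms by (subst mult_four_block_mat[of _ a a _ d _ d]) auto

text \<open>Deflation: completing an eigenvector to a unitary basis clears the first column below
  the diagonal, normality then clears the first row as well, and the induction continues on the
  remaining block, which is again normal. The diagonal follows the given factorization, so the
  eigenvalues can later be listed in any chosen order.\<close>

lemma normal_mat_unitary_diagonalization:
  assumes "A \<in> carrier_mat n n" "normal_mat A" "char_poly A = (\<Prod>e\<leftarrow>es. [:- e, 1:])"
  shows "\<exists>U\<in>carrier_mat n n. mat_adjoint U * U = 1\<^sub>m n \<and>
    mat_adjoint U * A * U = mat_diag n (\<lambda>i. es ! i)"
  using assms
proof (induction es arbitrary: n A)
  case Nil
  hence "n = 0" using degree_monic_char_poly[of A n] by simp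
  thus ?case using Nil.prems by (intro bexI[of _ "1\<^sub>m 0"]) (auto simp: mat_diag_def)
next
  case (Cons e es n A)
  note A = Cons.prems(1)
  from Cons.prems(3)
  have cp: "char_poly A = [: -e, 1 :] * (\<Prod>e \<leftarrow> es. [:- e, 1:])" by auto
  have mon: "monic (\<Prod>e\<leftarrow> es. [:- e, 1:])" by (rule monic_prod_list, auto)
  have deg: "degree (char_poly A) = Suc (degree (\<Prod>e\<leftarrow> es. [:- e, 1:]))" unfolding cp
    by (subst degree_mult_eq, insert mon, auto)
  with degree_monic_char_poly[OF A] obtain m where n: "n = Suc m" by (cases n) auto
  hence n0: "0 < n" by simp
  have "eigenvalue A e" unfolding eigenvalue_root_char_poly[OF A] cp by simp
  then obtain v where v: "v \<in> carrier_vec n" "v \<noteq> 0\<^sub>v n" and Av: "A *\<^sub>v v = e \<cdot>\<^sub>v v"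
    using A unfolding eigenvalue_def eigenvector_def by auto
  from unitary_with_first_column[OF v] obtain W c where W: "W \<in> carrier_mat n n"
    and WW: "mat_adjoint W * W = 1\<^sub>m n" and colW: "col W 0 = c \<cdot>\<^sub>v v" by auto
  note WW' = unitary_inverse[OF W WW]
  have W' [simp]: "mat_adjoint W \<in> carrier_mat n n" using W by simp
  define A' where "A' = mat_adjoint W * A * W"
  have A' [simp]: "A' \<in> carrier_mat n n" using W A unfolding A'_def by (simp add: square_assoc[where n=n])
  note dimA' [simp] = carrier_matD[OF A']
  have col0: "A' $$ (i, 0) = (if i = 0 then e else 0)" if "i < n" for i
  proof -
    have "A' $$ (i, 0) = col (mat_adjoint W * (A * W)) 0 $ i"
      using that n A W W' unfolding A'_def by (subst assoc_mult_mat[OF W' A W]) auto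
    also have "col (mat_adjoint W * (A * W)) 0 = mat_adjoint W *\<^sub>v (A *\<^sub>v col W 0)"
      unfolding col_mult2[OF W' mult_carrier_square[OF A W] n0] col_mult2[OF A W n0] ..
    also have "A *\<^sub>v col W 0 = e \<cdot>\<^sub>v col W 0"
      unfolding colW using A v by (simp add: mult_mat_vec[OF A v(1)] Av smult_smult_assoc mult.commute)
    also have "mat_adjoint W *\<^sub>v (e \<cdot>\<^sub>v col W 0) = e \<cdot>\<^sub>v col (mat_adjoint W * W) 0"
      using n W W' by (subst mult_mat_vec[OF W', of "col W 0"]) (auto simp: col_mult2[OF W' W] intro: col_carrier_vec)
    also have "\<dots> $ i = (if i = 0 then e else 0)" using that n unfolding WW by auto
    finally show ?thesis .
  qed
  have conj_mult: "mat_adjoint W * X * W * (mat_adjoint W * Y * W) = mat_adjoint W * (X * Y) * W"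
    if X: "X \<in> carrier_mat n n" and Y: "Y \<in> carrier_mat n n" for X Y
  proof -
    have "mat_adjoint W * X * W * (mat_adjoint W * Y * W) 
      = mat_adjoint W * X * (W * mat_adjoint W) * Y * W"
      using X Y W W' by (simp add: square_assoc[where n=n])
    thus ?thesis using X Y W W' unfolding WW' by (simp add: square_assoc[where n=n])
  qed
  have adjA': "mat_adjoint A' = mat_adjoint W * mat_adjoint A * W"
    using A W W' unfolding A'_def by (simp add: mat_adjoint_mult square_assoc[where n=n])
  have normA': "mat_adjoint A' * A' = A' * mat_adjoint A'"
    using Cons.prems(2) A unfolding adjA' unfolding A'_def 
    by (simp add: conj_mult normal_mat_def)
  have row0: "A' $$ (0, j) = 0" if "0 < j" "j < n" for j
  proof -
    \<comment> \<open>Normality at position \<open>(0, 0)\<close> equates the squared norms of the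
      first column and the first row. The column contributes only its entry \<open>e\<close>, which
      the row contains too, so all other entries of the row vanish.\<close>
    have "complex_of_real (\<Sum>l<n. (cmod (A' $$ (l, 0)))\<^sup>2) = (mat_adjoint A' * A') $$ (0, 0)"
      using n by (subst index_mult_mat_sum) (auto simp: complex_norm_square mult.commute simp del: of_real_power)
    also have "\<dots> = complex_of_real (\<Sum>l<n. (cmod (A' $$ (0, l)))\<^sup>2)"
      unfolding normA' using n by (subst index_mult_mat_sum) (auto simp: complex_norm_square mult.commute simp del: of_real_power)
    finally have "(\<Sum>l<n. (cmod (A' $$ (l, 0)))\<^sup>2) = (\<Sum>l<n. (cmod (A' $$ (0, l)))\<^sup>2)"
      by (simp only: of_real_eq_iff)
    hence "(\<Sum>l<m. (cmod (A' $$ (0, Suc l)))\<^sup>2) = 0"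
      unfolding n sum.lessThan_Suc_shift using n by (simp add: col0)
    hence "\<forall>l\<in>{..<m}. (cmod (A' $$ (0, Suc l)))\<^sup>2 = 0" 
      by (subst (asm) sum_nonneg_eq_0_iff) auto
    thus ?thesis using that n by (cases j) auto
  qed
  define A1 where "A1 = Matrix.mat 1 1 (\<lambda>_. e)"
  define A3 where "A3 = Matrix.mat m m (\<lambda>(i, j). A' $$ (Suc i, Suc j))"
  have A1 [simp]: "A1 \<in> carrier_mat 1 1" and A3 [simp]: "A3 \<in> carrier_mat m m" 
    unfolding A1_def A3_def by auto
  have A'block: "A' = four_block_mat A1 (0\<^sub>m 1 m) (0\<^sub>m m 1) A3"
  proof (rule eq_matI)
    fix i j assume ij: "i < dim_row (four_block_mat A1 (0\<^sub>m 1 m) (0\<^sub>m m 1) A3)"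
      "j < dim_col (four_block_mat A1 (0\<^sub>m 1 m) (0\<^sub>m m 1) A3)"
    hence "i < n" "j < n" using n by (auto simp: A1_def A3_def)
    thus "A' $$ (i, j) = four_block_mat A1 (0\<^sub>m 1 m) (0\<^sub>m m 1) A3 $$ (i, j)"
      using col0[of i] row0[of j] n by (cases i; cases j) (simp_all add: A1_def A3_def)
  qed (simp_all add: n A1_def A3_def)
  have adjA'block: "mat_adjoint A' = four_block_mat (mat_adjoint A1) (0\<^sub>m 1 m) (0\<^sub>m m 1) (mat_adjoint A3)"
    unfolding A'block by (rule eq_matI) (use carrier_matD[OF A1] carrier_matD[OF A3] in auto)
  have "A' * mat_adjoint A' = four_block_mat (A1 * mat_adjoint A1) (0\<^sub>m 1 m) (0\<^sub>m m 1) (A3 * mat_adjoint A3)"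
    unfolding adjA'block unfolding A'block
    by (rule four_block_diag_mult[OF A1 A3 mat_adjoint_carrier[OF A1] mat_adjoint_carrier[OF A3]])
  moreover have "mat_adjoint A' * A' = four_block_mat (mat_adjoint A1 * A1) (0\<^sub>m 1 m) (0\<^sub>m m 1) (mat_adjoint A3 * A3)"
    unfolding adjA'block unfolding A'block
    by (rule four_block_diag_mult[OF mat_adjoint_carrier[OF A1] mat_adjoint_carrier[OF A3] A1 A3])
  ultimately have eq: "four_block_mat (mat_adjoint A1 * A1) (0\<^sub>m 1 m) (0\<^sub>m m 1) (mat_adjoint A3 * A3)
      = four_block_mat (A1 * mat_adjoint A1) (0\<^sub>m 1 m) (0\<^sub>m m 1) (A3 * mat_adjoint A3)"
    using normA' by simp
  have "mat_adjoint A3 * A3 = A3 * mat_adjoint A3"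
  proof (rule eq_matI)
    fix i j assume ij: "i < dim_row (A3 * mat_adjoint A3)" "j < dim_col (A3 * mat_adjoint A3)"
    show "(mat_adjoint A3 * A3) $$ (i, j) = (A3 * mat_adjoint A3) $$ (i, j)"
      using arg_cong[OF eq, of "\<lambda>M. M $$ (Suc i, Suc j)"] ij carrier_matD[OF A1] carrier_matD[OF A3]
      by (simp del: index_mult_mat(1))
  qed (use carrier_matD[OF A3] in auto)
  hence norm3: "normal_mat A3" unfolding normal_mat_def using carrier_matD[OF A3] by simp
  have "similar_mat_wit A' A (mat_adjoint W) W"
    by (rule similar_mat_witI[of _ _ n]) (use A W WW WW' A' W' in \<open>auto simp: A'_def\<close>)
  hence "char_poly A' = char_poly A" by (intro char_poly_similar) (auto simp: similar_mat_def)
  moreover have "char_poly A' = char_poly A1 * char_poly A3" 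
    unfolding A'block by (rule char_poly_four_block_zeros_col[OF A1 _ A3]) auto
  moreover have "char_poly A1 = [: -e,1 :]"
    by (simp add: A1_def char_poly_defs det_def sign_def)
  ultimately have "char_poly A3 = (\<Prod> e \<leftarrow> es. [:- e, 1:])"
    using cp by (metis mult_cancel_left pCons_eq_0_iff zero_neq_one)
  from Cons.IH[OF A3 norm3 this] obtain U where U [simp]: "U \<in> carrier_mat m m"
    and UU: "mat_adjoint U * U = 1\<^sub>m m" 
    and UA: "mat_adjoint U * A3 * U = mat_diag m (\<lambda>i. es ! i)" by auto
  define F where "F = four_block_mat (1\<^sub>m 1) (0\<^sub>m 1 m) (0\<^sub>m m 1) U"
  have F [simp]: "F \<in> carrier_mat n n" unfolding F_def 
    using four_block_carrier_mat[OF one_carrier_mat[of 1] U] n by simp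
  have adjF: "mat_adjoint F = four_block_mat (1\<^sub>m 1) (0\<^sub>m 1 m) (0\<^sub>m m 1) (mat_adjoint U)"
    by (rule eq_matI) (use carrier_matD[OF U] in \<open>auto simp: F_def\<close>)
  have FF: "mat_adjoint F * F = 1\<^sub>m n"
    unfolding adjF unfolding F_def 
    by (subst four_block_diag_mult[OF one_carrier_mat mat_adjoint_carrier[OF U] one_carrier_mat U])
      (auto simp: UU n)
  have FAF: "mat_adjoint F * A' * F = mat_diag n (\<lambda>i. (e # es) ! i)"
  proof -
    have "mat_adjoint F * A' * F = four_block_mat A1 (0\<^sub>m 1 m) (0\<^sub>m m 1) (mat_adjoint U * A3 * U)"
      unfolding adjF A'block unfolding F_def 
      by (subst four_block_diag_mult[OF one_carrier_mat mat_adjoint_carrier[OF U] A1 A3],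
          subst four_block_diag_mult[OF _ _ one_carrier_mat U]) 
        (use A1 A3 mat_adjoint_carrier[OF U] in \<open>simp_all add: mult_carrier_square\<close>)
    also have "\<dots> = mat_diag n (\<lambda>i. (e # es) ! i)"
      unfolding UA by (rule eq_matI) (auto simp: A1_def n mat_diag_def)
    finally show ?thesis .
  qed
  have adjWF: "mat_adjoint (W * F) = mat_adjoint F * mat_adjoint W"
    using W carrier_matD[OF F] by (simp add: mat_adjoint_mult)
  have "mat_adjoint (W * F) * (W * F) = mat_adjoint F * (mat_adjoint W * W) * F"
    using W W' F by (simp add: adjWF square_assoc[where n=n])
  hence 1: "mat_adjoint (W * F) * (W * F) = 1\<^sub>m n" unfolding WW using FF F by simp
  have "mat_adjoint (W * F) * A * (W * F) = mat_adjoint F * A' * F"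
    using W W' F A unfolding A'_def by (simp add: adjWF square_assoc[where n=n])
  with 1 FAF W F show ?case by (intro bexI[of _ "W * F"]) auto
qed

section \<open>Zero dilations and isotropic subspaces\<close>

lemma is_zero_dilation_unitary_conj:
  assumes A: "A \<in> carrier_mat n n" and U: "U \<in> carrier_mat n n" "mat_adjoint U * U = 1\<^sub>m n"
    and dil: "is_zero_dilation (mat_adjoint U * A * U) r"
  shows "is_zero_dilation A r"
proof -
  have U' [simp]: "mat_adjoint U \<in> carrier_mat n n" using U by simp
  have "dim_row (mat_adjoint U * A * U) = n" using U by simp
  then obtain V where V: "V \<in> carrier_mat n r" and VV: "mat_adjoint V * V = 1\<^sub>m r"
    and VAV: "mat_adjoint V * (mat_adjoint U * A * U) * V = 0\<^sub>m r r"
    using dil unfolding is_zero_dilation_def by auto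
  have V': "mat_adjoint V \<in> carrier_mat r n" using V by simp
  have UV: "U * V \<in> carrier_mat n r" using mult_carrier_mat[OF U(1) V] .
  have adj: "mat_adjoint (U * V) = mat_adjoint V * mat_adjoint U"
    using U carrier_matD[OF V] by (simp add: mat_adjoint_mult)
  have "mat_adjoint U * (U * V) = V"
    unfolding assoc_mult_mat[OF U' U(1) V, symmetric] U(2) using V by simp
  hence 1: "mat_adjoint (U * V) * (U * V) = 1\<^sub>m r"
    unfolding adj assoc_mult_mat[OF V' U' UV] using VV by simp
  have "mat_adjoint (U * V) * A * (U * V) = mat_adjoint V * (mat_adjoint U * A * U) * V"
  proof -
    have UA: "mat_adjoint U * A \<in> carrier_mat n n" and UAU: "mat_adjoint U * A * U \<in> carrier_mat n n"
      using mult_carrier_square[OF U' A] mult_carrier_square[OF _ U(1)] by auto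
    have VUA: "mat_adjoint V * (mat_adjoint U * A) \<in> carrier_mat r n"
      using mult_carrier_mat[OF V' UA] .
    show ?thesis unfolding adj assoc_mult_mat[OF V' U' A]
      assoc_mult_mat[OF VUA U(1) V, symmetric] assoc_mult_mat[OF V' UA U(1)] ..
  qed
  hence "mat_adjoint (U * V) * A * (U * V) = 0\<^sub>m r r" using VAV by simp
  thus ?thesis using 1 UV A unfolding is_zero_dilation_def by auto
qed

lemma is_zero_dilation_unitary_iff:
  assumes A: "A \<in> carrier_mat n n" and U: "U \<in> carrier_mat n n" "mat_adjoint U * U = 1\<^sub>m n"
  shows "is_zero_dilation (mat_adjoint U * A * U) r \<longleftrightarrow> is_zero_dilation A r"
proof
  assume "is_zero_dilation A r"
  note U' = mat_adjoint_carrier[OF U(1)] and UU' = unitary_inverse[OF U]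
  have "mat_adjoint (mat_adjoint U) * (mat_adjoint U * A * U) * mat_adjoint U 
    = (U * mat_adjoint U) * A * (U * mat_adjoint U)"
    using A U(1) U' by (simp add: square_assoc[where n=n])
  also have "\<dots> = A" using A unfolding UU' by simp
  finally have "is_zero_dilation (mat_adjoint (mat_adjoint U) * (mat_adjoint U * A * U) * mat_adjoint U) r"
    using \<open>is_zero_dilation A r\<close> by simp
  thus "is_zero_dilation (mat_adjoint U * A * U) r"
    by (rule is_zero_dilation_unitary_conj[rotated -1])
      (use A U U' UU' in \<open>simp_all add: mult_carrier_square\<close>)
qed (rule is_zero_dilation_unitary_conj[OF assms])

text \<open>The Gram matrix \<open>mat_adjoint M * M\<close> is Hermitian, hence unitarily
  diagonalizable, and injectivity makes its diagonal positive. Rescaling the rotated columns by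
  inverse square roots gives an isometry, and isotropy survives both changes of basis.\<close>

lemma is_zero_dilation_injective:
  assumes A: "A \<in> carrier_mat n n" and M: "M \<in> carrier_mat n r"
    and inj: "\<And>x. x \<in> carrier_vec r \<Longrightarrow> M *\<^sub>v x = 0\<^sub>v n \<Longrightarrow> x = 0\<^sub>v r"
    and iso: "mat_adjoint M * A * M = 0\<^sub>m r r"
  shows "is_zero_dilation A r"
proof -
  have M': "mat_adjoint M \<in> carrier_mat r n" using M by simp
  have G: "mat_adjoint M * M \<in> carrier_mat r r" using mult_carrier_mat[OF M' M] .
  have "mat_adjoint (mat_adjoint M * M) = mat_adjoint M * M" by (simp add: mat_adjoint_mult)
  hence "normal_mat (mat_adjoint M * M)" using G unfolding normal_mat_def by simp
  moreover obtain es where "char_poly (mat_adjoint M * M) = (\<Prod>e\<leftarrow>es. [:- e, 1:])"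
    using char_poly_factorized[OF G] by auto
  ultimately obtain U where U: "U \<in> carrier_mat r r" and UU: "mat_adjoint U * U = 1\<^sub>m r" and
    UGU: "mat_adjoint U * (mat_adjoint M * M) * U = mat_diag r (\<lambda>i. es ! i)"
    using normal_mat_unitary_diagonalization[OF G] by blast
  have U': "mat_adjoint U \<in> carrier_mat r r" using U by simp
  define N where "N = M * U"
  have N: "N \<in> carrier_mat n r" using mult_carrier_mat[OF M U] unfolding N_def .
  have N': "mat_adjoint N \<in> carrier_mat r n" using N by simp
  have adjN: "mat_adjoint N = mat_adjoint U * mat_adjoint M"
    unfolding N_def using M U by (simp add: mat_adjoint_mult)
  have NN: "mat_adjoint N * N = mat_diag r (\<lambda>i. es ! i)"
    unfolding UGU[symmetric] adjN unfolding N_def 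
      assoc_mult_mat[OF mult_carrier_mat[OF U' M'] M U, symmetric] assoc_mult_mat[OF U' M' M] ..
  have NAN: "mat_adjoint N * A * N = 0\<^sub>m r r"
  proof -
    note MA = mult_carrier_mat[OF M' A]
    have "mat_adjoint N * A * N = mat_adjoint U * (mat_adjoint M * A * M) * U"
      unfolding adjN unfolding N_def assoc_mult_mat[OF U' M' A] assoc_mult_mat[OF U' MA mult_carrier_mat[OF M U]]
        assoc_mult_mat[OF MA M U, symmetric] 
        assoc_mult_mat[OF U' mult_carrier_mat[OF MA M] U, symmetric] ..
    thus ?thesis unfolding iso using U by simp
  qed
  define t where "t i = (\<Sum>l<n. (cmod (N $$ (l, i)))\<^sup>2)" for i
  have es: "es ! i = of_real (t i)" if "i < r" for i
  proof -
    have "es ! i = (mat_adjoint N * N) $$ (i, i)" using that unfolding NN by (simp add: mat_diag_def)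
    also have "\<dots> = of_real (t i)" using that N unfolding t_def 
      by (subst index_mult_mat_sum) (auto simp: complex_norm_square mult.commute simp del: of_real_power)
    finally show ?thesis .
  qed
  have t: "t i > 0" if i: "i < r" for i
  proof -
    have "t i \<noteq> 0"
    proof
      assume "t i = 0"
      hence "\<forall>l\<in>{..<n}. (cmod (N $$ (l, i)))\<^sup>2 = 0" 
        unfolding t_def by (subst (asm) sum_nonneg_eq_0_iff) auto
      hence "col N i = 0\<^sub>v n" using N i by (intro eq_vecI) auto
      moreover have "col N i = M *\<^sub>v col U i" unfolding N_def using col_mult2[OF M U i] .
      moreover have cU: "col U i \<in> carrier_vec r" using U i by auto
      ultimately have "col U i = 0\<^sub>v r" using inj by auto
      hence "(mat_adjoint U * U) $$ (i, i) = 0" using U i by simp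
      thus False using i unfolding UU by simp
    qed
    moreover have "t i \<ge> 0" unfolding t_def by (intro sum_nonneg) auto
    ultimately show ?thesis by simp
  qed
  define s where "s i = complex_of_real (1 / sqrt (t i))" for i
  define V where "V = N * mat_diag r s"
  have S: "mat_diag r s \<in> carrier_mat r r" by simp
  have V: "V \<in> carrier_mat n r" unfolding V_def using mult_carrier_mat[OF N S] .
  have adjS: "mat_adjoint (mat_diag r s) = mat_diag r s"
    by (rule eq_matI) (auto simp: mat_diag_def s_def)
  have adjV: "mat_adjoint V = mat_diag r s * mat_adjoint N"
    unfolding V_def using N carrier_matD[OF S] by (simp add: mat_adjoint_mult adjS)
  have conjV: "mat_adjoint V * X * V = mat_diag r s * (mat_adjoint N * X * N) * mat_diag r s"
    if X: "X \<in> carrier_mat n n" for X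
  proof -
    note NX = mult_carrier_mat[OF N' X]
    show ?thesis unfolding adjV unfolding V_def assoc_mult_mat[OF S N' X] 
      assoc_mult_mat[OF S NX mult_carrier_mat[OF N S]] assoc_mult_mat[OF NX N S, symmetric] 
      assoc_mult_mat[OF S mult_carrier_mat[OF NX N] S, symmetric] ..
  qed
  have V': "mat_adjoint V \<in> carrier_mat r n" using V by simp
  \<comment> \<open>The identity matrix is inserted so that \<open>conjV\<close> covers the Gram
    matrix as well.\<close>
  have "mat_adjoint V * V = mat_adjoint V * 1\<^sub>m n * V" using right_mult_one_mat[OF V'] by simp
  also have "\<dots> = mat_diag r s * (mat_adjoint N * 1\<^sub>m n * N) * mat_diag r s" by (rule conjV) simp
  also have "\<dots> = mat_diag r (\<lambda>i. s i * es ! i * s i)"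
    using right_mult_one_mat[OF N'] NN by simp
  also have "\<dots> = 1\<^sub>m r"
  proof (rule eq_matI)
    fix i j assume ij: "i < dim_row (1\<^sub>m r :: complex mat)" "j < dim_col (1\<^sub>m r :: complex mat)"
    have "s j * es ! j * s j = 1"
    proof -
      have "1 / sqrt (t j) * t j * (1 / sqrt (t j)) = 1" using t[of j] ij by (simp add: field_simps)
      hence "complex_of_real (1 / sqrt (t j) * t j * (1 / sqrt (t j))) = 1" by simp
      thus ?thesis using es[of j] ij unfolding s_def by (simp only: of_real_mult) simp
    qed
    thus "mat_diag r (\<lambda>i. s i * es ! i * s i) $$ (i, j) = 1\<^sub>m r $$ (i, j)" 
      using ij by (simp add: mat_diag_def)
  qed (simp_all add: mat_diag_def)
  finally have "mat_adjoint V * V = 1\<^sub>m r" .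
  moreover have "mat_adjoint V * A * V = 0\<^sub>m r r"
    unfolding conjV[OF A] NAN using right_mult_zero_mat[OF S] left_mult_zero_mat[OF S] by simp
  ultimately show ?thesis using V A unfolding is_zero_dilation_def by auto
qed

text \<open>The quadratic form \<open>\<Sum> d\<^sub>j |x\<^sub>j|\<^sup>2\<close> vanishes on an \<open>r\<close>-dimensional subspace of
  \<open>\<complex>\<^sup>I\<close>, spanned by \<open>f 0, \<dots>, f (r - 1)\<close>.\<close>
definition isotropic_dim :: "nat set \<Rightarrow> (nat \<Rightarrow> complex) \<Rightarrow> nat \<Rightarrow> bool" where
  "isotropic_dim I d r \<longleftrightarrow> (\<exists>f :: nat \<Rightarrow> nat \<Rightarrow> complex.
    (\<forall>c. (\<forall>j\<in>I. (\<Sum>a<r. f a j * c a) = 0) \<longrightarrow> (\<forall>a<r. c a = 0)) \<and>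
    (\<forall>a<r. \<forall>b<r. (\<Sum>j\<in>I. cnj (f a j) * d j * f b j) = 0))"

lemma isotropic_dim_imp_zero_dilation:
  assumes "isotropic_dim {..<n} d r"
  shows "is_zero_dilation (mat_diag n d) r"
proof -
  from assms[unfolded isotropic_dim_def] obtain f :: "nat \<Rightarrow> nat \<Rightarrow> complex" where 
    f: "\<forall>c. (\<forall>j\<in>{..<n}. (\<Sum>a<r. f a j * c a) = 0) \<longrightarrow> (\<forall>a<r. c a = 0)"
    and iso: "\<forall>a<r. \<forall>b<r. (\<Sum>j<n. cnj (f a j) * d j * f b j) = 0" by (elim exE conjE)
  have indep: "c a = 0" if "\<And>j. j < n \<Longrightarrow> (\<Sum>a<r. f a j * c a) = 0" "a < r" for c a
    using f[THEN spec, of c] that by simp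
  define M where "M = Matrix.mat n r (\<lambda>(j, a). f a j)"
  have M: "M \<in> carrier_mat n r" unfolding M_def by simp
  show ?thesis
  proof (rule is_zero_dilation_injective[OF _ M])
    fix x assume x: "x \<in> carrier_vec r" "M *\<^sub>v x = 0\<^sub>v n"
    have "(\<Sum>a<r. f a j * x $ a) = 0" if "j < n" for j
    proof -
      have "(M *\<^sub>v x) $ j = (\<Sum>a<r. f a j * x $ a)"
        using that x(1) unfolding M_def by (simp add: scalar_prod_def lessThan_atLeast0)
      thus ?thesis using x(2) that by simp
    qed
    hence "x $ a = 0" if "a < r" for a using indep[of "\<lambda>a. x $ a"] that by blast
    thus "x = 0\<^sub>v r" using x(1) by (intro eq_vecI) auto
  next
    show "mat_adjoint M * mat_diag n d * M = 0\<^sub>m r r"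
    proof (rule eq_matI)
      fix a b assume "a < dim_row (0\<^sub>m r r :: complex mat)" "b < dim_col (0\<^sub>m r r :: complex mat)"
      thus "(mat_adjoint M * mat_diag n d * M) $$ (a, b) = 0\<^sub>m r r $$ (a, b)"
        using iso[THEN spec, of a] mat_adjoint_carrier[OF M]
        by (subst mat_diag_mult_right[of _ r]) (auto simp: M_def scalar_prod_def lessThan_atLeast0)
    qed (simp_all add: M_def)
  qed simp
qed

text \<open>Dimension count: if the bound failed, the range of \<open>V\<close> would contain a
  nonzero vector supported on the indices in the open half-plane. The form multiplied by
  \<open>c\<close> has positive real part at such a vector, although it vanishes on the
  range.\<close>

lemma zero_dilation_halfplane:
  assumes dil: "is_zero_dilation (mat_diag n d) r"
  shows "card {i \<in> {..<n}. Re (c * d i) > 0} + r \<le> n"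
proof (rule ccontr)
  assume neg: "\<not> ?thesis"
  define S where "S = {i \<in> {..<n}. Re (c * d i) > 0}"
  define T where "T = {..<n} - S"
  have "card T = n - card S" unfolding T_def S_def by (subst card_Diff_subset) auto
  moreover have "card S \<le> n" using card_mono[of "{..<n}" S] unfolding S_def by auto
  ultimately have cT: "card T < r" using neg unfolding S_def by linarith
  have finT: "finite T" unfolding T_def by simp
  obtain g where g: "bij_betw g {..<card T} T" 
    using ex_bij_betw_nat_finite[OF finT] by (auto simp: lessThan_atLeast0)
  have "dim_row (mat_diag n d) = n" by (simp add: mat_diag_def)
  then obtain V where V: "V \<in> carrier_mat n r" and VV: "mat_adjoint V * V = 1\<^sub>m r"
    and VDV: "mat_adjoint V * mat_diag n d * V = 0\<^sub>m r r"
    using dil unfolding is_zero_dilation_def by auto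
  \<comment> \<open>The rows of \<open>V\<close> outside the half-plane, padded with zero rows to a
    square matrix. As \<open>card T < r\<close>, at least the last row is padding, so
    \<open>B\<close> is singular; a kernel vector \<open>x\<close> makes
    \<open>V *\<^sub>v x\<close> vanish on \<open>T\<close>.\<close>
  define B where "B = Matrix.mat r r (\<lambda>(i, j). if i < card T then V $$ (g i, j) else 0)"
  have B: "B \<in> carrier_mat r r" unfolding B_def by simp
  have "det B = 0"
  proof -
    have "det B = (\<Sum>j<r. B $$ (r - 1, j) * cofactor B (r - 1) j)"
      using laplace_expansion_row[OF B, of "r - 1"] cT by simp
    also have "\<dots> = 0" using cT by (intro sum.neutral) (auto simp: B_def)
    finally show ?thesis .
  qed
  then obtain x where x: "x \<in> carrier_vec r" "x \<noteq> 0\<^sub>v r" "B *\<^sub>v x = 0\<^sub>v r"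
    using det_0_iff_vec_prod_zero[OF B] by auto
  define y where "y = V *\<^sub>v x"
  have y: "y \<in> carrier_vec n" using V x unfolding y_def by simp
  have y0: "y $ l = 0" if "l \<in> T" for l
  proof -
    have "l \<in> g ` {..<card T}" using g that unfolding bij_betw_def by blast
    then obtain i where i: "i < card T" "l = g i" by auto
    have l: "l < n" using that unfolding T_def by simp
    have "y $ l = (B *\<^sub>v x) $ i" using i l cT V x(1) unfolding y_def B_def
      by (simp add: scalar_prod_def)
    thus ?thesis using x(3) i cT by simp
  qed
  \<comment> \<open>The vector as a single column, so that the value of the form becomes a matrix
    product.\<close>
  define X where "X = Matrix.mat r 1 (\<lambda>(i, _). x $ i)"
  have X: "X \<in> carrier_mat r 1" unfolding X_def by simp
  have V': "mat_adjoint V \<in> carrier_mat r n" and X': "mat_adjoint X \<in> carrier_mat 1 r" using V X by auto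
  have VX: "V * X \<in> carrier_mat n 1" using mult_carrier_mat[OF V X] .
  have VXi: "(V * X) $$ (l, 0) = y $ l" if "l < n" for l
    using that V x(1) unfolding X_def y_def 
    by (auto simp: scalar_prod_def intro!: sum.cong)
  have adjVXi: "mat_adjoint (V * X) $$ (0, l) = cnj (y $ l)" if "l < n" for l
    using VXi[OF that] that carrier_matD[OF VX] by (subst mat_adjoint_index) auto
  have D: "mat_diag n d \<in> carrier_mat n n" by simp
  have adjVX: "mat_adjoint (V * X) = mat_adjoint X * mat_adjoint V" 
    using V X by (simp add: mat_adjoint_mult)
  have "mat_adjoint (V * X) * mat_diag n d * (V * X) = mat_adjoint X * (mat_adjoint V * mat_diag n d * V) * X"
  proof -
    note VD = mult_carrier_mat[OF V' D]
    show ?thesis unfolding adjVX assoc_mult_mat[OF X' V' D] assoc_mult_mat[OF X' VD VX]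
      assoc_mult_mat[OF VD V X, symmetric] assoc_mult_mat[OF X' mult_carrier_mat[OF VD V] X, symmetric] ..
  qed
  hence "mat_adjoint (V * X) * mat_diag n d * (V * X) = 0\<^sub>m 1 1" unfolding VDV using X X' by simp
  hence "(mat_adjoint (V * X) * mat_diag n d * (V * X)) $$ (0, 0) = 0" by simp
  moreover have "(mat_adjoint (V * X) * mat_diag n d * (V * X)) $$ (0, 0) 
    = (\<Sum>l<n. of_real ((cmod (y $ l))\<^sup>2) * d l)"
    using mat_adjoint_carrier[OF VX] VX
    by (subst mat_diag_mult_right[of _ 1], simp, subst index_mult_mat_sum)
      (auto simp: VXi adjVXi complex_norm_square mult_ac simp del: of_real_power index_mult_mat(1))
  ultimately have "(\<Sum>l<n. of_real ((cmod (y $ l))\<^sup>2) * d l) = 0" by simp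
  hence "c * (\<Sum>l<n. of_real ((cmod (y $ l))\<^sup>2) * d l) = 0" by simp
  hence "Re (\<Sum>l<n. of_real ((cmod (y $ l))\<^sup>2) * (c * d l)) = 0" 
    by (simp add: sum_distrib_left mult_ac del: of_real_power)
  hence sum0: "(\<Sum>l<n. (cmod (y $ l))\<^sup>2 * Re (c * d l)) = 0" by (simp del: of_real_power)
  have "\<forall>l\<in>{..<n}. (cmod (y $ l))\<^sup>2 * Re (c * d l) = 0"
  proof (subst sum_nonneg_eq_0_iff[symmetric])
    fix l assume l: "l \<in> {..<n}"
    show "0 \<le> (cmod (y $ l))\<^sup>2 * Re (c * d l)"
      using y0[of l] l by (cases "l \<in> T") (auto simp: T_def S_def)
  qed (use sum0 in auto)
  hence "y $ l = 0" if "l < n" for l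
    using y0[of l] that by (cases "l \<in> T") (auto simp: T_def S_def)
  hence "y = 0\<^sub>v n" using y by (intro eq_vecI) auto
  hence "mat_adjoint V *\<^sub>v (V *\<^sub>v x) = 0\<^sub>v r" unfolding y_def using V by auto
  hence "x = 0\<^sub>v r" using assoc_mult_mat_vec[OF V' V x(1)] x(1) unfolding VV by simp
  thus False using x by simp
qed

section \<open>Construction of isotropic subspaces\<close>

lemma isotropic_dim_0: "isotropic_dim I d 0"
  unfolding isotropic_dim_def by simp

text \<open>Extending both families by zero gives a direct sum: mixed products have disjoint
  supports, and independence is tested on \<open>I\<close> and on \<open>J\<close>
  separately.\<close>

lemma isotropic_dim_union:
  assumes "isotropic_dim I d r" "isotropic_dim J d s" "finite I" "finite J" "I \<inter> J = {}"
  shows "isotropic_dim (I \<union> J) d (r + s)"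
proof -
  from assms(1)[unfolded isotropic_dim_def] obtain f :: "nat \<Rightarrow> nat \<Rightarrow> complex" where 
    f: "\<forall>c. (\<forall>j\<in>I. (\<Sum>a<r. f a j * c a) = 0) \<longrightarrow> (\<forall>a<r. c a = 0)"
    and f0: "\<forall>a<r. \<forall>b<r. (\<Sum>j\<in>I. cnj (f a j) * d j * f b j) = 0" by (elim exE conjE)
  from assms(2)[unfolded isotropic_dim_def] obtain g :: "nat \<Rightarrow> nat \<Rightarrow> complex" where 
    g: "\<forall>c. (\<forall>j\<in>J. (\<Sum>a<s. g a j * c a) = 0) \<longrightarrow> (\<forall>a<s. c a = 0)"
    and g0: "\<forall>a<s. \<forall>b<s. (\<Sum>j\<in>J. cnj (g a j) * d j * g b j) = 0" by (elim exE conjE)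
  define h where "h a j = (if a < r then if j \<in> I then f a j else 0
    else if j \<in> J then g (a - r) j else 0)" for a j
  have split: "(\<Sum>a<r + s. h a j * c a) = (\<Sum>a<r. h a j * c a) + (\<Sum>a<s. h (r + a) j * c (r + a))"
    for j and c :: "nat \<Rightarrow> complex"
    by (induction s) simp_all
  have notI: "j \<notin> I" if "j \<in> J" for j using assms(5) that by auto
  have notJ: "j \<notin> J" if "j \<in> I" for j using assms(5) that by auto
  have "\<forall>a<r + s. c a = 0" if c: "\<forall>j\<in>I \<union> J. (\<Sum>a<r + s. h a j * c a) = 0" for c
  proof -
    have "\<forall>j\<in>I. (\<Sum>a<r. f a j * c a) = 0"
    proof
      fix j assume "j \<in> I"
      thus "(\<Sum>a<r. f a j * c a) = 0" using c[rule_format, of j] notJ[of j] 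
        unfolding split by (simp add: h_def)
    qed
    hence 1: "\<forall>a<r. c a = 0" using f by blast
    have "\<forall>j\<in>J. (\<Sum>a<s. g a j * c (r + a)) = 0"
    proof
      fix j assume "j \<in> J"
      thus "(\<Sum>a<s. g a j * c (r + a)) = 0" using c[rule_format, of j] notI[of j] 
        unfolding split by (simp add: h_def)
    qed
    hence 2: "\<forall>a<s. c (r + a) = 0" using g[THEN spec, of "\<lambda>a. c (r + a)"] by blast
    show ?thesis
    proof (intro allI impI)
      fix a assume "a < r + s"
      thus "c a = 0" using 1 2[THEN spec, of "a - r"] by (cases "a < r") auto
    qed
  qed
  moreover have "(\<Sum>j\<in>I \<union> J. cnj (h a j) * d j * h b j) = 0" if ab: "a < r + s" "b < r + s" for a b
  proof -
    have "(\<Sum>j\<in>I \<union> J. cnj (h a j) * d j * h b j) 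
      = (\<Sum>j\<in>I. cnj (h a j) * d j * h b j) + (\<Sum>j\<in>J. cnj (h a j) * d j * h b j)"
      using assms(3-5) by (rule sum.union_disjoint)
    also have "(\<Sum>j\<in>I. cnj (h a j) * d j * h b j) = 0"
    proof (cases "a < r \<and> b < r")
      case True
      hence "(\<Sum>j\<in>I. cnj (h a j) * d j * h b j) = (\<Sum>j\<in>I. cnj (f a j) * d j * f b j)"
        by (intro sum.cong) (auto simp: h_def)
      thus ?thesis using f0 True by simp
    next
      case False
      thus ?thesis using notJ by (intro sum.neutral) (auto simp: h_def)
    qed
    also have "(\<Sum>j\<in>J. cnj (h a j) * d j * h b j) = 0"
    proof (cases "a < r \<or> b < r")
      case True
      thus ?thesis using notI by (intro sum.neutral) (auto simp: h_def)
    next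
      case False
      hence "(\<Sum>j\<in>J. cnj (h a j) * d j * h b j) = (\<Sum>j\<in>J. cnj (g (a - r) j) * d j * g (b - r) j)"
        by (intro sum.cong) (auto simp: h_def)
      moreover have "a - r < s" "b - r < s" using False ab by auto
      ultimately show ?thesis using g0 by simp
    qed
    finally show ?thesis by simp
  qed
  ultimately show ?thesis unfolding isotropic_dim_def by (intro exI[of _ h]) blast
qed

lemma isotropic_dim_superset:
  assumes "isotropic_dim J d r" "J \<subseteq> I" "finite I"
  shows "isotropic_dim I d r"
proof -
  have "isotropic_dim (J \<union> (I - J)) d (r + 0)"
    using assms by (intro isotropic_dim_union isotropic_dim_0) (auto intro: finite_subset)
  moreover have "J \<union> (I - J) = I" using assms by auto
  ultimately show ?thesis by simp
qed

lemma isotropic_dim_1I: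
  assumes "finite I" "j \<in> I" "v j \<noteq> 0" "(\<Sum>j\<in>I. cnj (v j) * d j * v j) = 0"
  shows "isotropic_dim I d 1"
  unfolding isotropic_dim_def using assms by (intro exI[of _ "\<lambda>_. v"]) auto

lemma isotropic_dim_zeros:
  assumes "finite Z" "\<And>j. j \<in> Z \<Longrightarrow> d j = 0"
  shows "isotropic_dim Z d (card Z)"
  using assms
proof (induction Z rule: finite_induct)
  case (insert z Z)
  have "isotropic_dim ({z} \<union> Z) d (1 + card Z)"
    using insert by (intro isotropic_dim_union insert.IH isotropic_dim_1I[of _ z "\<lambda>_. 1"]) auto
  thus ?case using insert by simp
qed (simp add: isotropic_dim_0)

text \<open>The squared moduli of coordinates can be any nonnegative weights, so the square roots of
  the weights span an isotropic line.\<close>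

lemma isotropic_dim_weights:
  assumes "finite I" "j \<in> I" "w j > 0" "\<And>j. j \<in> I \<Longrightarrow> w j \<ge> 0" 
    "(\<Sum>j\<in>I. of_real (w j) * d j) = 0"
  shows "isotropic_dim I d 1"
proof (rule isotropic_dim_1I)
  have "(\<Sum>j\<in>I. cnj (of_real (sqrt (w j))) * d j * of_real (sqrt (w j))) = (\<Sum>j\<in>I. of_real (w j) * d j)"
  proof (rule sum.cong)
    fix j assume "j \<in> I"
    hence "complex_of_real (sqrt (w j)) * of_real (sqrt (w j)) = of_real (w j)"
      using assms(4)[of j] by (simp flip: of_real_mult)
    thus "cnj (of_real (sqrt (w j))) * d j * of_real (sqrt (w j)) = of_real (w j) * d j"
      by (metis complex_cnj_complex_of_real mult.assoc mult.commute)
  qed simp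
  thus "(\<Sum>j\<in>I. cnj (of_real (sqrt (w j))) * d j * of_real (sqrt (w j))) = 0"
    using assms(5) by simp
qed (use assms in auto)

lemma isotropic_dim_convex_hull:
  assumes "finite I" "0 \<in> convex hull (d ` I)"
  shows "isotropic_dim I d 1"
proof -
  \<comment> \<open>Equal eigenvalues may occur at several indices, whereas convex weights belong to
    points. Choosing one index per point transfers the weights without counting any of them
    twice.\<close>
  obtain J where J: "J \<subseteq> I" "inj_on d J" "d ` I = d ` J"
    by (metis order_refl subset_image_inj)
  have finJ: "finite J" using J assms(1) by (auto intro: finite_subset)
  obtain u where u: "\<And>x. x \<in> d ` J \<Longrightarrow> u x \<ge> 0" "sum u (d ` J) = 1" "(\<Sum>x\<in>d ` J. u x *\<^sub>R x) = 0"
    using assms(2) finJ unfolding J(3) by (subst (asm) convex_hull_finite) auto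
  have "(\<Sum>j\<in>J. u (d j)) = 1" using u(2) J(2) by (simp add: sum.reindex)
  then obtain j where j: "j \<in> J" "u (d j) \<noteq> 0" by (metis sum.neutral zero_neq_one)
  hence "u (d j) > 0" using u(1)[of "d j"] by simp
  hence "isotropic_dim J d 1"
    using finJ j u(1,3) J(2) 
    by (intro isotropic_dim_weights[of _ j "\<lambda>j. u (d j)"]) (auto simp: sum.reindex scaleR_conv_of_real)
  thus ?thesis using J(1) assms(1) by (rule isotropic_dim_superset)
qed

section \<open>Lagrange interpolation and balanced configurations\<close>

lemma lagrange_sum_zero:
  fixes u :: "'b \<Rightarrow> 'a :: field"
  assumes fin: "finite I" and inj: "inj_on u I" and e: "e + 1 < card I"
  shows "(\<Sum>i\<in>I. u i ^ e / (\<Prod>j\<in>I - {i}. u i - u j)) = 0"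
proof -
  \<comment> \<open>\<open>L\<close> is the Lagrange interpolant of the monomial of degree
    \<open>e\<close> at the nodes \<open>u i\<close>. It equals that monomial, whose degree is below
    \<open>card I - 1\<close>, so its coefficient at \<open>card I - 1\<close> vanishes; this
    coefficient is the sum in question.\<close>
  define c where "c i = u i ^ e / (\<Prod>j\<in>I - {i}. u i - u j)" for i
  define P where "P i = (\<Prod>j\<in>I - {i}. [:- u j, 1:])" for i
  define L where "L = (\<Sum>i\<in>I. smult (c i) (P i))"
  have degP: "degree (P i) = card I - 1" if "i \<in> I" for i
    unfolding P_def using that fin by (subst degree_prod_sum_eq) auto
  have leadP: "coeff (P i) (card I - 1) = 1" if "i \<in> I" for i
    using lead_coeff_prod[of "\<lambda>j. [:- u j, 1:]" "I - {i}"] degP[OF that] unfolding P_def by simp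
  have evalP: "poly (P i) (u l) = (if l = i then (\<Prod>j\<in>I - {i}. u i - u j) else 0)"
    if "i \<in> I" "l \<in> I" for i l
    using that fin unfolding P_def by (auto simp: poly_prod)
  have nz: "(\<Prod>j\<in>I - {i}. u i - u j) \<noteq> 0" if "i \<in> I" for i
    using that inj fin by (auto simp: inj_on_def)
  have "L = monom 1 e"
  proof (rule poly_eqI_degree)
    fix x assume "x \<in> u ` I"
    then obtain l where l: "l \<in> I" "x = u l" by auto
    have "poly L x = (\<Sum>i\<in>I. if i = l then u l ^ e else 0)"
      unfolding L_def poly_sum poly_smult
      by (rule sum.cong) (use l nz in \<open>auto simp: evalP c_def\<close>)
    also have "\<dots> = poly (monom 1 e) x" using l fin by (simp add: poly_monom)
    finally show "poly L x = poly (monom 1 e) x" .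
  next
    have "degree L \<le> card I - 1" unfolding L_def 
      by (rule degree_sum_le[OF fin]) (metis degP degree_smult_le)
    thus "card (u ` I) > degree L" using e inj by (simp add: card_image)
    show "card (u ` I) > degree (monom (1::'a) e)" using e inj by (simp add: card_image degree_monom_eq)
  qed
  hence "coeff L (card I - 1) = 0" using e by simp
  moreover have "coeff L (card I - 1) = (\<Sum>i\<in>I. c i)"
    unfolding L_def coeff_sum coeff_smult by (rule sum.cong) (use leadP in simp_all)
  ultimately show ?thesis unfolding c_def by simp
qed

lemma prod_sign_balanced:
  fixes g :: "'a \<Rightarrow> real"
  assumes "finite P" "finite N" "P \<inter> N = {}" "\<And>j. j \<in> P \<Longrightarrow> g j > 0" "\<And>j. j \<in> N \<Longrightarrow> g j < 0"
  shows "(-1) ^ card N * prod g (P \<union> N) > 0"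
proof -
  have "(-1) ^ card N * prod g N = (\<Prod>j\<in>N. - g j)" by (simp add: prod_uminus)
  hence "(-1) ^ card N * prod g (P \<union> N) = prod g P * (\<Prod>j\<in>N. - g j)"
    using assms by (simp add: prod.union_disjoint mult_ac)
  moreover have "prod g P > 0" "(\<Prod>j\<in>N. - g j) > 0" using assms by (auto intro!: prod_pos)
  ultimately show ?thesis by simp
qed

text \<open>With \<open>u\<^sub>j = d\<^sub>j / cnj d\<^sub>j\<close>, Lagrange interpolation annihilates all monomials in \<open>d\<^sub>j\<close> and
  \<open>cnj d\<^sub>j\<close> of degree \<open>2p - 1\<close>. The interpolation weights all have the same sign because every
  line through a point has \<open>p\<close> points on either side, so their square roots turn binary forms of
  degree \<open>p - 1\<close> into isotropic vectors.\<close>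
lemma isotropic_dim_balanced:
  assumes fin: "finite I" and card: "card I = 2 * p + 1" and nz: "\<And>j. j \<in> I \<Longrightarrow> d j \<noteq> 0"
    and pos: "\<And>i. i \<in> I \<Longrightarrow> card {j \<in> I. Im (cnj (d i) * d j) > 0} = p"
    and neg: "\<And>i. i \<in> I \<Longrightarrow> card {j \<in> I. Im (cnj (d i) * d j) < 0} = p"
  shows "isotropic_dim I d p"
\<comment> \<open>The exponents \<open>2 * p - 1\<close> and \<open>p - 1\<close> used below are
  truncated at \<open>p = 0\<close>, where the claim is trivial.\<close>
proof (cases "p = 0")
  case True
  thus ?thesis by (simp add: isotropic_dim_0)
next
  case False
  define cr where "cr i j = Im (cnj (d i) * d j)" for i j
  define B where "B i = (\<Prod>j\<in>I - {i}. cr i j)" for i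
  define W where "W i = (-1) ^ p * B i" for i
  define u where "u i = d i / cnj (d i)" for i
  \<comment> \<open>The two counts add up to \<open>card I - 1\<close>, so \<open>i\<close> is the
    only index on its own line through 0.\<close>
  have off: "I - {i} = {j \<in> I. cr i j > 0} \<union> {j \<in> I. cr i j < 0}" if i: "i \<in> I" for i
  proof -
    have "{j \<in> I. cr i j > 0} \<union> {j \<in> I. cr i j < 0} = I - {i}"
    proof (rule card_subset_eq)
      show "{j \<in> I. cr i j > 0} \<union> {j \<in> I. cr i j < 0} \<subseteq> I - {i}" by (auto simp: cr_def mult.commute)
      have "card ({j \<in> I. cr i j > 0} \<union> {j \<in> I. cr i j < 0}) = p + p"
        using pos[OF i] neg[OF i] fin unfolding cr_def by (subst card_Un_disjoint) auto
      thus "card ({j \<in> I. cr i j > 0} \<union> {j \<in> I. cr i j < 0}) = card (I - {i})"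
        using i card fin by simp
    qed (use fin in simp)
    thus ?thesis by simp
  qed
  have W: "W i > 0" if i: "i \<in> I" for i
  proof -
    have disj: "{j \<in> I. cr i j > 0} \<inter> {j \<in> I. cr i j < 0} = {}" by auto
    have "(-1) ^ card {j \<in> I. cr i j < 0} * prod (cr i) ({j \<in> I. cr i j > 0} \<union> {j \<in> I. cr i j < 0}) > 0"
      using fin disj by (intro prod_sign_balanced) auto
    moreover have "card {j \<in> I. cr i j < 0} = p" using neg[OF i] unfolding cr_def .
    ultimately show ?thesis unfolding W_def B_def off[OF i] by (simp only:)
  qed
  \<comment> \<open>Up to factors that depend on one eigenvalue each, a cross product is a
    difference of nodes \<open>u\<close>. Hence nonzero cross products make the nodes distinct, and
    products of them become Lagrange denominators.\<close>
  have cr_u: "of_real (cr i j) = cnj (d i) * cnj (d j) * (u j - u i) / (2 * \<i>)" if "i \<in> I" "j \<in> I" for i j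
  proof -
    have "cnj (d i) * cnj (d j) * (u j - u i) = cnj (d i) * d j - d i * cnj (d j)"
      using nz that unfolding u_def by (simp add: field_simps)
    also have "\<dots> = 2 * \<i> * of_real (cr i j)" unfolding cr_def by (simp add: complex_eq_iff)
    finally show ?thesis by simp
  qed
  have cr_nz: "cr i j \<noteq> 0" if "i \<in> I" "j \<in> I" "i \<noteq> j" for i j
  proof -
    have "j \<in> {j \<in> I. cr i j > 0} \<union> {j \<in> I. cr i j < 0}" using that off[OF that(1)] by blast
    thus ?thesis by auto
  qed
  have inj: "inj_on u I"
  proof (rule inj_onI, rule ccontr)
    fix i j assume "i \<in> I" "j \<in> I" "u i = u j" "i \<noteq> j"
    thus False using cr_u[of i j] cr_nz[of i j] by simp
  qed
  define K where "K = (\<Prod>j\<in>I. cnj (d j)) / (2 * \<i>) ^ (2 * p)"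
  \<comment> \<open>Each of the \<open>2 * p\<close> factors contributes one
    \<open>cnj (d i)\<close>. Completing the product of the \<open>cnj (d j)\<close> to all of
    \<open>I\<close> uses up one of these, which leaves the exponent \<open>2 * p - 1\<close> and a
    constant \<open>K\<close> independent of \<open>i\<close>.\<close>
  have B_u: "of_real (B i) = cnj (d i) ^ (2 * p - 1) * K * (\<Prod>j\<in>I - {i}. u i - u j)" if i: "i \<in> I" for i
  proof -
    have cardi: "card (I - {i}) = 2 * p" using i card fin by simp
    have "complex_of_real (B i) = (\<Prod>j\<in>I - {i}. (- cnj (d i) / (2 * \<i>)) * (cnj (d j) * (u i - u j)))"
      unfolding B_def of_real_prod by (rule prod.cong) (use i in \<open>auto simp: cr_u field_simps\<close>)
    also have "\<dots> = (- cnj (d i) / (2 * \<i>)) ^ (2 * p) * (\<Prod>j\<in>I - {i}. cnj (d j)) * (\<Prod>j\<in>I - {i}. u i - u j)"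
      unfolding prod.distrib prod_constant cardi by (simp only: mult.assoc)
    also have "(- cnj (d i) / (2 * \<i>)) ^ (2 * p) = cnj (d i) ^ (2 * p) / (2 * \<i>) ^ (2 * p)"
      using uminus_power_if[of "cnj (d i)" "2 * p"] by (simp only: power_divide) simp
    also have "cnj (d i) ^ (2 * p) = cnj (d i) ^ (2 * p - 1) * cnj (d i)"
      using False by (metis power_Suc2 Suc_pred' mult_pos_pos neq0_conv zero_less_numeral)
    finally show ?thesis
      using fin i unfolding K_def by (subst prod.remove[of I i]) (simp_all add: mult_ac)
  qed
  \<comment> \<open>In total degree \<open>2 * p - 1\<close> the monomial is \<open>u i ^ e\<close>
    times exactly the power of \<open>cnj (d i)\<close> that occurs in \<open>W i\<close>.
    Interpolation applies because \<open>e + 1 \<le> 2 * p < card I\<close>.\<close>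
  have key: "(\<Sum>i\<in>I. d i ^ e * cnj (d i) ^ e' / of_real (W i)) = 0" if ee: "e + e' = 2 * p - 1" for e e'
  proof -
    have "d i ^ e * cnj (d i) ^ e' / of_real (W i) 
      = (-1) ^ p / K * (u i ^ e / (\<Prod>j\<in>I - {i}. u i - u j))" if i: "i \<in> I" for i
    proof -
      have "d i ^ e * cnj (d i) ^ e' = u i ^ e * cnj (d i) ^ (2 * p - 1)"
        using nz[OF i] unfolding u_def ee[symmetric] by (simp add: power_add power_divide)
      moreover have "complex_of_real (W i) = (-1) ^ p * cnj (d i) ^ (2 * p - 1) * K * (\<Prod>j\<in>I - {i}. u i - u j)"
        unfolding W_def of_real_mult B_u[OF i] by simp
      ultimately show ?thesis using nz[OF i] by (cases "even p") simp_all
    qed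
    hence "(\<Sum>i\<in>I. d i ^ e * cnj (d i) ^ e' / of_real (W i)) 
      = (-1) ^ p / K * (\<Sum>i\<in>I. u i ^ e / (\<Prod>j\<in>I - {i}. u i - u j))"
      unfolding sum_distrib_left by (intro sum.cong) auto
    also have "\<dots> = 0" using lagrange_sum_zero[OF fin inj, of e] ee card False by simp
    finally show ?thesis .
  qed
  \<comment> \<open>A product of two such vectors carries the weight \<open>1 / W j\<close>.
    Together with the factor \<open>d j\<close> of the form its degree is
    \<open>2 * (p - 1) + 1 = 2 * p - 1\<close>, which is what \<open>key\<close>
    annihilates.\<close>
  define f where "f a j = d j ^ a * cnj (d j) ^ (p - 1 - a) / of_real (sqrt (W j))" for a j
  have "(\<Sum>j\<in>I. cnj (f a j) * d j * f b j) = 0" if ab: "a < p" "b < p" for a b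
  proof -
    have "cnj (f a j) * d j * f b j = d j ^ (p - a + b) * cnj (d j) ^ (a + (p - 1 - b)) / of_real (W j)"
      if j: "j \<in> I" for j
    proof -
      have "complex_of_real (sqrt (W j)) * of_real (sqrt (W j)) = of_real (W j)"
        using W[OF j] by (simp flip: of_real_mult)
      moreover have "d j ^ (p - a + b) = d j ^ (p - 1 - a) * d j * d j ^ b"
      proof -
        have "p - a + b = (p - 1 - a) + 1 + b" using ab by simp
        thus ?thesis by (simp only: power_add power_one_right)
      qed
      ultimately show ?thesis using nz[OF j] unfolding f_def by (auto simp: power_add mult_ac)
    qed
    thus ?thesis using key[of "p - a + b" "a + (p - 1 - b)"] ab by simp
  qed
  moreover have "\<forall>a<p. c a = 0" if c: "\<forall>j\<in>I. (\<Sum>a<p. f a j * c a) = 0" for c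
  proof -
    \<comment> \<open>Up to a nonzero factor, the linear combination at \<open>j\<close> is
      \<open>Q\<close> evaluated at \<open>u j\<close>. So \<open>Q\<close> has degree at most
      \<open>p\<close> and vanishes at \<open>2 * p + 1\<close> distinct nodes.\<close>
    define Q where "Q = (\<Sum>a<p. monom (c a) a)"
    have "Q = 0"
    proof (rule poly_eqI_degree)
      fix x assume "x \<in> u ` I"
      then obtain j where j: "j \<in> I" "x = u j" by auto
      have "f a j * c a = cnj (d j) ^ (p - 1) / of_real (sqrt (W j)) * (c a * u j ^ a)" if "a < p" for a
      proof -
        have "cnj (d j) ^ (p - 1) = cnj (d j) ^ a * cnj (d j) ^ (p - 1 - a)"
          using that by (simp flip: power_add)
        thus ?thesis using nz[OF j(1)] unfolding f_def u_def by (simp add: power_divide)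
      qed
      hence "(\<Sum>a<p. f a j * c a) = cnj (d j) ^ (p - 1) / of_real (sqrt (W j)) * poly Q x"
        unfolding Q_def poly_sum poly_monom sum_distrib_left j(2) by (intro sum.cong) auto
      thus "poly Q x = poly 0 x" using c j(1) nz[OF j(1)] W[OF j(1)] by simp
    next
      have "degree Q \<le> p" unfolding Q_def
        by (rule degree_sum_le) (auto intro: order_trans[OF degree_monom_le])
      thus "card (u ` I) > degree Q" using inj card by (simp add: card_image)
      show "card (u ` I) > degree (0 :: complex poly)" using inj card by (simp add: card_image)
    qed
    moreover have "coeff Q a = c a" if "a < p" for a
      using that unfolding Q_def by (simp add: coeff_sum)
    ultimately show ?thesis by (metis coeff_0)
  qed
  ultimately show ?thesis unfolding isotropic_dim_def by (intro exI[of _ f]) blast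
qed

text \<open>\<open>ccw z w\<close> and \<open>cw z w\<close> say that \<open>arg (w / z)\<close> lies in \<open>[0, \<pi>)\<close> and
  in \<open>(-\<pi>, 0]\<close>, respectively.\<close>
definition ccw :: "complex \<Rightarrow> complex \<Rightarrow> bool" where
  "ccw z w \<longleftrightarrow> Im (cnj z * w) > 0 \<or> Im (cnj z * w) = 0 \<and> Re (cnj z * w) > 0"

definition cw :: "complex \<Rightarrow> complex \<Rightarrow> bool" where
  "cw z w \<longleftrightarrow> Im (cnj z * w) < 0 \<or> Im (cnj z * w) = 0 \<and> Re (cnj z * w) > 0"

section \<open>Half-open half-planes and opposite pairs\<close>

lemma cnj_mult_nonzero:
  assumes "z \<noteq> 0" "w \<noteq> 0"
  shows "Im (cnj z * w) \<noteq> 0 \<or> Re (cnj z * w) \<noteq> 0"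
proof -
  have "cnj z * w \<noteq> 0" using assms by simp
  thus ?thesis using complex_eq_iff zero_complex.sel by metis
qed

text \<open>With one boundary ray included, each region contains exactly one of two opposite nonzero
  vectors. Open or closed half-planes would contain none or both of a pair on the boundary
  line.\<close>

lemma ccw_neg:
  assumes "z \<noteq> 0" "w \<noteq> 0" "t > 0"
  shows "ccw z (- of_real t * w) \<longleftrightarrow> \<not> ccw z w" "cw z (- of_real t * w) \<longleftrightarrow> \<not> cw z w"
proof -
  have "cnj z * (- of_real t * w) = of_real (- t) * (cnj z * w)" by simp
  hence *: "Im (cnj z * (- of_real t * w)) = - t * Im (cnj z * w)" 
    "Re (cnj z * (- of_real t * w)) = - t * Re (cnj z * w)"
    by (simp_all add: algebra_simps)
  show "ccw z (- of_real t * w) \<longleftrightarrow> \<not> ccw z w" "cw z (- of_real t * w) \<longleftrightarrow> \<not> cw z w"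
    using cnj_mult_nonzero[OF assms(1,2)] assms(3) unfolding ccw_def cw_def *
    by (auto simp: zero_less_mult_iff mult_less_0_iff)
qed

lemma opposite_eq:
  assumes "z \<noteq> 0" "Im (cnj z * w) = 0" "Re (cnj z * w) < 0"
  shows "\<exists>t>0. w = - of_real t * z"
proof -
  define q where "q = Re (cnj z * w)"
  have q: "cnj z * w = of_real q" using assms(2) by (simp add: q_def complex_eq_iff)
  have "of_real ((cmod z)\<^sup>2) * w = z * (cnj z * w)" by (simp add: complex_norm_square mult_ac del: of_real_power)
  hence "w = - of_real (- q / (cmod z)\<^sup>2) * z" using assms(1) unfolding q by (simp add: field_simps)
  moreover have "- q / (cmod z)\<^sup>2 > 0" using assms(1,3) unfolding q_def by (simp add: divide_pos_pos)
  ultimately show ?thesis by blast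
qed

lemma card_remove_one_of_two:
  assumes "finite I" "i \<in> I" "j \<in> I" "P j \<longleftrightarrow> \<not> P i"
  shows "card {l \<in> I - {i, j}. P l} = card {l \<in> I. P l} - 1"
proof (cases "P i")
  case True
  hence "{l \<in> I - {i, j}. P l} = {l \<in> I. P l} - {i}" using assms by auto
  thus ?thesis using True assms by simp
next
  case False
  hence "{l \<in> I - {i, j}. P l} = {l \<in> I. P l} - {j}" using assms by auto
  thus ?thesis using False assms by simp
qed

text \<open>Removing an opposite pair lowers each of the counts by exactly one; without opposite
  pairs the bounds force all arguments to be distinct and the configuration to be balanced.\<close>
lemma isotropic_dim_odd:
  assumes "finite I" "card I = 2 * p + 1" "\<And>j. j \<in> I \<Longrightarrow> d j \<noteq> 0"
    and "\<And>i. i \<in> I \<Longrightarrow> card {j \<in> I. ccw (d i) (d j)} \<le> p + 1"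
    and "\<And>i. i \<in> I \<Longrightarrow> card {j \<in> I. cw (d i) (d j)} \<le> p + 1"
  shows "isotropic_dim I d p"
  using assms
proof (induction p arbitrary: I)
  case 0
  show ?case by (rule isotropic_dim_0)
next
  case (Suc p I)
  show ?case
  proof (cases "\<exists>i\<in>I. \<exists>j\<in>I. Im (cnj (d i) * d j) = 0 \<and> Re (cnj (d i) * d j) < 0")
    case True
    then obtain i j where ij: "i \<in> I" "j \<in> I" "Im (cnj (d i) * d j) = 0" "Re (cnj (d i) * d j) < 0" by auto
    from opposite_eq[OF Suc.prems(3)[OF ij(1)] ij(3,4)] obtain t where t: "t > 0" "d j = - of_real t * d i" by auto
    have "i \<noteq> j"
    proof
      assume "i = j"
      hence "Re (cnj (d i) * d j) \<ge> 0" by simp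
      thus False using ij by simp
    qed
    have "isotropic_dim (I - {i, j}) d p"
    proof (rule Suc.IH)
      show "card (I - {i, j}) = 2 * p + 1" 
        using Suc.prems(1,2) ij \<open>i \<noteq> j\<close> by (subst card_Diff_subset) auto
    next
      fix l assume l: "l \<in> I - {i, j}"
      hence l0: "d l \<noteq> 0" "d i \<noteq> 0" using Suc.prems(3) ij by auto
      show "card {m \<in> I - {i, j}. ccw (d l) (d m)} \<le> p + 1" "card {m \<in> I - {i, j}. cw (d l) (d m)} \<le> p + 1"
        using card_remove_one_of_two[OF Suc.prems(1) ij(1,2), of "\<lambda>m. ccw (d l) (d m)"]
          card_remove_one_of_two[OF Suc.prems(1) ij(1,2), of "\<lambda>m. cw (d l) (d m)"]
          ccw_neg[OF l0 t(1)] Suc.prems(4,5)[of l] l unfolding t(2) by auto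
    qed (use Suc.prems in auto)
    \<comment> \<open>Since \<open>d j = - of_real t * d i\<close>, the weights \<open>t\<close> at
      \<open>i\<close> and 1 at \<open>j\<close> cancel.\<close>
    moreover have "isotropic_dim {i, j} d 1"
      by (rule isotropic_dim_weights[of _ i "\<lambda>l. if l = i then t else 1"])
        (use t \<open>i \<noteq> j\<close> in auto)
    ultimately have "isotropic_dim ((I - {i, j}) \<union> {i, j}) d (p + 1)"
      using Suc.prems(1) by (intro isotropic_dim_union) auto
    moreover have "(I - {i, j}) \<union> {i, j} = I" using ij by auto
    ultimately show ?thesis by simp
  next
    case False
    have "card {j \<in> I. Im (cnj (d i) * d j) > 0} = Suc p \<and> card {j \<in> I. Im (cnj (d i) * d j) < 0} = Suc p"
      if i: "i \<in> I" for i
    proof -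
      define P where "P = {j \<in> I. Im (cnj (d i) * d j) > 0}"
      define N where "N = {j \<in> I. Im (cnj (d i) * d j) < 0}"
      define Z where "Z = {j \<in> I. Im (cnj (d i) * d j) = 0 \<and> Re (cnj (d i) * d j) > 0}"
      have fin: "finite P" "finite N" "finite Z" using Suc.prems(1) unfolding P_def N_def Z_def by auto
      have "I = P \<union> N \<union> Z"
        using False i cnj_mult_nonzero[OF Suc.prems(3)[OF i] Suc.prems(3)]
        unfolding P_def N_def Z_def by (force simp: not_less)
      moreover have "card (P \<union> N \<union> Z) = card P + card N + card Z"
        using fin by (subst card_Un_disjoint, auto simp: P_def N_def Z_def, subst card_Un_disjoint, auto)
      ultimately have 1: "card P + card N + card Z = 2 * Suc p + 1" using Suc.prems(2) by simp
      have "{j \<in> I. ccw (d i) (d j)} = P \<union> Z" "{j \<in> I. cw (d i) (d j)} = N \<union> Z"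
        unfolding P_def N_def Z_def ccw_def cw_def by auto
      moreover have "card (P \<union> Z) = card P + card Z" "card (N \<union> Z) = card N + card Z"
        using fin by (subst card_Un_disjoint, auto simp: P_def N_def Z_def)+
      ultimately have 2: "card P + card Z \<le> Suc p + 1" "card N + card Z \<le> Suc p + 1"
        using Suc.prems(4,5)[OF i] by auto
      \<comment> \<open>Adding the two bounds in \<open>2\<close> and subtracting the total in
        \<open>1\<close> gives \<open>card Z \<le> 1\<close>. As \<open>i\<close> itself lies in
        \<open>Z\<close>, equality holds, and \<open>P\<close> and \<open>N\<close>, of size at most
        \<open>Suc p\<close> each, share the remaining \<open>2 * Suc p\<close> indices
        equally.\<close>
      have "Re (cnj (d i) * d i) > 0"
        using Suc.prems(3)[OF i] by (simp add: complex_eq_iff sum_squares_gt_zero_iff)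
      hence "i \<in> Z" using i unfolding Z_def by (simp add: mult.commute)
      hence "card Z > 0" using fin by (auto simp: card_gt_0_iff)
      with 1 2 have "card P = Suc p \<and> card N = Suc p" by presburger
      thus ?thesis unfolding P_def N_def .
    qed
    thus ?thesis using Suc.prems(1-3) by (intro isotropic_dim_balanced) auto
  qed
qed

section \<open>Arguments of the eigenvalues\<close>

lemma polar_Arg2pi: "z = of_real (cmod z) * cis (Arg2pi z)"
  by (metis Arg2pi_eq cis_conv_exp)

text \<open>The difference of two arguments ranges strictly between minus and plus a full turn. The
  second alternative in each equivalence is the part of the half-plane that is reached by wrapping
  around.\<close>

lemma ccw_cw_Arg2pi:
  assumes "z \<noteq> 0" "w \<noteq> 0"
  shows "ccw z w \<longleftrightarrow> 0 \<le> Arg2pi w - Arg2pi z \<and> Arg2pi w - Arg2pi z < pi \<or> Arg2pi w - Arg2pi z < - pi"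
    and "cw z w \<longleftrightarrow> - pi < Arg2pi w - Arg2pi z \<and> Arg2pi w - Arg2pi z \<le> 0 \<or> Arg2pi w - Arg2pi z > pi"
proof -
  define t where "t = Arg2pi w - Arg2pi z"
  have t: "- (2 * pi) < t" "t < 2 * pi"
    using Arg2pi_ge_0[of z] Arg2pi_ge_0[of w] Arg2pi_lt_2pi[of z] Arg2pi_lt_2pi[of w] 
    unfolding t_def by linarith+
  have "cnj z * w = of_real (cmod z) * cis (- Arg2pi z) * (of_real (cmod w) * cis (Arg2pi w))"
    by (metis polar_Arg2pi cis_cnj complex_cnj_complex_of_real complex_cnj_mult)
  also have "\<dots> = of_real (cmod z * cmod w) * cis t" by (simp add: t_def cis_mult)
  finally have Im: "Im (cnj z * w) = cmod z * cmod w * sin t" 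
    and Re: "Re (cnj z * w) = cmod z * cmod w * cos t" by simp_all
  have pos: "cmod z * cmod w > 0" using assms by simp
  have ccw: "ccw z w \<longleftrightarrow> sin t > 0 \<or> sin t = 0 \<and> cos t > 0"
    and cw: "cw z w \<longleftrightarrow> sin t < 0 \<or> sin t = 0 \<and> cos t > 0"
    using pos unfolding ccw_def cw_def Im Re 
    by (auto simp: zero_less_mult_iff mult_less_0_iff)
  consider "t < - pi" | "t = - pi" | "- pi < t" "t < 0" | "t = 0" | "0 < t" "t < pi" | "t = pi" | "t > pi"
    by linarith
  hence "(ccw z w \<longleftrightarrow> 0 \<le> t \<and> t < pi \<or> t < - pi) \<and> (cw z w \<longleftrightarrow> - pi < t \<and> t \<le> 0 \<or> t > pi)"
  proof cases
    case 1
    hence "sin (- t) < 0" using t by (intro sin_lt_zero) auto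
    moreover have "\<not> 0 \<le> t" "\<not> pi < t" using 1 pi_gt_zero by linarith+
    ultimately show ?thesis using 1 unfolding ccw cw by auto
  next
    case 3
    hence "sin (- t) > 0" by (intro sin_gt_zero) auto
    moreover have "\<not> 0 \<le> t" "\<not> t < - pi" "\<not> pi < t" using 3 pi_gt_zero by linarith+
    ultimately show ?thesis using 3 unfolding ccw cw by auto
  next
    case 5
    hence "sin t > 0" by (intro sin_gt_zero) auto
    thus ?thesis using 5 unfolding ccw cw by auto
  next
    case 7
    hence "sin t < 0" using t by (intro sin_lt_zero) auto
    moreover have "\<not> t < pi" "\<not> t \<le> 0" "\<not> t < - pi" using 7 pi_gt_zero by linarith+
    ultimately show ?thesis using 7 unfolding ccw cw by auto
  qed (use pi_gt_zero in \<open>auto simp: ccw cw simp del: pi_gt_zero\<close>)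
  thus "ccw z w \<longleftrightarrow> 0 \<le> Arg2pi w - Arg2pi z \<and> Arg2pi w - Arg2pi z < pi \<or> Arg2pi w - Arg2pi z < - pi"
    and "cw z w \<longleftrightarrow> - pi < Arg2pi w - Arg2pi z \<and> Arg2pi w - Arg2pi z \<le> 0 \<or> Arg2pi w - Arg2pi z > pi"
    unfolding t_def by auto
qed

text \<open>With sorted angles, the gap bounds at distances \<open>p\<close> and
  \<open>p + 1\<close> confine the angles in the half-open half-plane to a cyclic window of
  \<open>p + 1\<close> indices.\<close>

lemma card_angles_ahead:
  fixes a :: "nat \<Rightarrow> real"
  assumes mono: "\<And>i j. 1 \<le> i \<Longrightarrow> i \<le> j \<Longrightarrow> j \<le> 2 * p + 1 \<Longrightarrow> a i \<le> a j"
    and le: "\<And>j. 1 \<le> j \<Longrightarrow> j \<le> p + 1 \<Longrightarrow> a (j + p) - a j \<le> pi"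
    and ge: "\<And>j. 1 \<le> j \<Longrightarrow> j \<le> p \<Longrightarrow> a (j + p + 1) - a j \<ge> pi"
    and i: "1 \<le> i" "i \<le> 2 * p + 1"
  shows "card {l \<in> {1..2 * p + 1}. 0 \<le> a l - a i \<and> a l - a i < pi \<or> a l - a i < - pi} \<le> p + 1"
proof -
  \<comment> \<open>The first of possibly several indices with this angle: smaller indices then have
    strictly smaller angles and cannot enter the window through ties.\<close>
  define j where "j = (LEAST l. 1 \<le> l \<and> a l = a i)"
  have j: "1 \<le> j" "a j = a i" using LeastI[of "\<lambda>l. 1 \<le> l \<and> a l = a i" i] i unfolding j_def by auto
  have ji: "j \<le> i" unfolding j_def using i by (intro Least_le) auto
  have less: "a l < a j" if "1 \<le> l" "l < j" for l
    using mono[of l j] not_less_Least[of l "\<lambda>l. 1 \<le> l \<and> a l = a i"] that ji i j 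
    unfolding j_def[symmetric] by fastforce
  define S where "S = {l \<in> {1..2 * p + 1}. 0 \<le> a l - a j \<and> a l - a j < pi \<or> a l - a j < - pi}"
  have "card S \<le> p + 1"
  proof (cases "j \<le> p")
    case True
    have "S \<subseteq> {j..j + p}"
    proof
      fix l assume "l \<in> S"
      hence l: "1 \<le> l" "l \<le> 2 * p + 1" "0 \<le> a l - a j \<and> a l - a j < pi \<or> a l - a j < - pi" 
        unfolding S_def by auto
      have "\<not> l < j"
      proof
        assume "l < j"
        hence "a j \<le> a (l + p)" "a (l + p) - a l \<le> pi" using mono[of j "l + p"] le[of l] l j True by auto
        thus False using l(3) less[OF l(1) \<open>l < j\<close>] by linarith
      qed
      moreover have "\<not> l > j + p"
      proof
        assume "l > j + p"
        hence "a l \<ge> a (j + p + 1)" using l by (intro mono) auto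
        moreover have "a (j + p + 1) - a j \<ge> pi" using ge[OF j(1) True] .
        ultimately show False using l(3) pi_gt_zero by linarith
      qed
      ultimately show "l \<in> {j..j + p}" by simp
    qed
    hence "card S \<le> card {j..j + p}" by (intro card_mono) auto
    thus ?thesis by simp
  next
    case False
    \<comment> \<open>Here the window wraps around. An index \<open>l < j\<close> can only qualify
      by lying more than \<open>pi\<close> behind, which the bound on the gap from
      \<open>j - p\<close> to \<open>j\<close> excludes for \<open>l \<ge> j - p\<close>.\<close>
    have "S \<subseteq> {j..2 * p + 1} \<union> {1..<j - p}"
    proof
      fix l assume "l \<in> S"
      hence l: "1 \<le> l" "l \<le> 2 * p + 1" "0 \<le> a l - a j \<and> a l - a j < pi \<or> a l - a j < - pi" 
        unfolding S_def by auto
      have "l < j - p" if "l < j"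
      proof (rule ccontr)
        assume "\<not> l < j - p"
        hence "a (j - p) \<le> a l" using l False by (intro mono) auto
        moreover have "a (j - p + p) - a (j - p) \<le> pi" using False ji i by (intro le) auto
        ultimately show False using l(3) less[OF l(1) that] False by simp
      qed
      thus "l \<in> {j..2 * p + 1} \<union> {1..<j - p}" using l(1,2) by force
    qed
    hence "card S \<le> card ({j..2 * p + 1} \<union> {1..<j - p})" by (intro card_mono) auto
    also have "\<dots> \<le> card {j..2 * p + 1} + card {1..<j - p}" by (rule card_Un_le)
    also have "\<dots> = p + 1" using False ji i by simp
    finally show ?thesis .
  qed
  thus ?thesis unfolding S_def j .
qed

text \<open>Reversing the indices and the signs of the angles swaps the two kinds of half-plane and
  preserves the gap conditions, so the previous count applies.\<close>

lemma card_angles_behind: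
  fixes a :: "nat \<Rightarrow> real"
  assumes mono: "\<And>i j. 1 \<le> i \<Longrightarrow> i \<le> j \<Longrightarrow> j \<le> 2 * p + 1 \<Longrightarrow> a i \<le> a j"
    and le: "\<And>j. 1 \<le> j \<Longrightarrow> j \<le> p + 1 \<Longrightarrow> a (j + p) - a j \<le> pi"
    and ge: "\<And>j. 1 \<le> j \<Longrightarrow> j \<le> p \<Longrightarrow> a (j + p + 1) - a j \<ge> pi"
    and i: "1 \<le> i" "i \<le> 2 * p + 1"
  shows "card {l \<in> {1..2 * p + 1}. - pi < a l - a i \<and> a l - a i \<le> 0 \<or> a l - a i > pi} \<le> p + 1"
    (is "card ?S \<le> _")
proof -
  define r where "r l = 2 * p + 2 - l" for l
  define b where "b l = - a (r l)" for l
  let ?T = "{l \<in> {1..2 * p + 1}. 0 \<le> b l - b (r i) \<and> b l - b (r i) < pi \<or> b l - b (r i) < - pi}"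
  have "r ` ?S \<subseteq> ?T"
  proof
    fix l assume "l \<in> r ` ?S"
    then obtain l' where l': "l' \<in> ?S" "l = r l'" by auto
    have "r l = l'" "r (r i) = i" using l' i unfolding r_def by auto
    thus "l \<in> ?T" using l' unfolding b_def by (auto simp: r_def)
  qed
  moreover have "inj_on r ?S" unfolding r_def inj_on_def by auto
  ultimately have "card ?S \<le> card ?T" by (intro card_inj_on_le) auto
  also have "\<dots> \<le> p + 1"
  proof (rule card_angles_ahead)
    fix i j assume "1 \<le> i" "i \<le> j" "j \<le> 2 * p + 1"
    thus "b i \<le> b j" unfolding b_def r_def using mono[of "2 * p + 2 - j" "2 * p + 2 - i"] by auto
  next
    fix j assume j: "1 \<le> j" "j \<le> p + 1"
    have "r (j + p) + p = r j" using j unfolding r_def by auto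
    thus "b (j + p) - b j \<le> pi" unfolding b_def using le[of "r (j + p)"] j by (auto simp: r_def)
  next
    fix j assume j: "1 \<le> j" "j \<le> p"
    have "r (j + p + 1) + p + 1 = r j" using j unfolding r_def by auto
    thus "b (j + p + 1) - b j \<ge> pi" unfolding b_def using ge[of "r (j + p + 1)"] j by (auto simp: r_def)
  qed (use i in \<open>auto simp: r_def\<close>)
  finally show ?thesis .
qed

lemma Re_cis_mult: "Re (cis (- t) * z) = cmod z * cos (Arg2pi z - t)"
proof -
  have "cis (- t) * z = of_real (cmod z) * cis (Arg2pi z - t)"
    by (subst polar_Arg2pi) (simp add: cis_mult)
  thus ?thesis by simp
qed

text \<open>The half-planes used are centred at the bisector of the two arguments and opposite to
  it. For a gap below \<open>pi\<close> the first contains all indices from \<open>i\<close> to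
  \<open>j\<close>; for a gap above \<open>pi\<close> the second contains all indices up to
  \<open>i\<close> and from \<open>j\<close> on. Either set would have more than \<open>q\<close>
  elements.\<close>

lemma angle_gaps_of_halfplanes:
  fixes lam :: "nat \<Rightarrow> complex"
  assumes nz: "\<And>j. 1 \<le> j \<Longrightarrow> j \<le> m \<Longrightarrow> lam j \<noteq> 0"
    and mono: "\<And>i j. 1 \<le> i \<Longrightarrow> i \<le> j \<Longrightarrow> j \<le> m \<Longrightarrow> Arg2pi (lam i) \<le> Arg2pi (lam j)"
    and half: "\<And>c. card {j \<in> {1..m}. Re (c * lam j) > 0} \<le> q"
    and ij: "1 \<le> i" "i \<le> j" "j \<le> m"
  shows "i + q \<le> j \<Longrightarrow> Arg2pi (lam j) - Arg2pi (lam i) \<ge> pi"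
    and "j + q \<le> i + m \<Longrightarrow> Arg2pi (lam j) - Arg2pi (lam i) \<le> pi"
proof -
  define a where "a l = Arg2pi (lam l)" for l
  define t where "t = (a i + a j) / 2"
  have bd: "0 \<le> a l" "a l < 2 * pi" for l unfolding a_def using Arg2pi_ge_0 Arg2pi_lt_2pi by auto
  have le: "a l \<le> a l'" if "1 \<le> l" "l \<le> l'" "l' \<le> m" for l l' unfolding a_def using mono that .
  have aij: "a i \<le> a j" using le ij by simp
  show "Arg2pi (lam j) - Arg2pi (lam i) \<ge> pi" if q: "i + q \<le> j"
  proof (rule ccontr)
    assume "\<not> ?thesis"
    hence lt: "a j - a i < pi" unfolding a_def by simp
    have "{i..j} \<subseteq> {l \<in> {1..m}. Re (cis (- t) * lam l) > 0}"
    proof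
      fix l assume l: "l \<in> {i..j}"
      have "a i \<le> a l" "a l \<le> a j" using l ij by (auto intro: le)
      hence "cos (a l - t) > 0" using lt unfolding t_def by (intro cos_gt_zero_pi) (simp_all add: field_simps)
      moreover have "lam l \<noteq> 0" using nz l ij by auto
      ultimately show "l \<in> {l \<in> {1..m}. Re (cis (- t) * lam l) > 0}"
        using l ij unfolding Re_cis_mult a_def by auto
    qed
    hence "card {i..j} \<le> card {l \<in> {1..m}. Re (cis (- t) * lam l) > 0}" by (intro card_mono) auto
    thus False using half[of "cis (- t)"] q by simp
  qed
  show "Arg2pi (lam j) - Arg2pi (lam i) \<le> pi" if q: "j + q \<le> i + m"
  proof (rule ccontr)
    assume "\<not> ?thesis"
    hence gt: "a j - a i > pi" unfolding a_def by simp
    hence "i \<noteq> j" using pi_gt_zero by auto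
    have "{1..i} \<union> {j..m} \<subseteq> {l \<in> {1..m}. Re (cis (- (t - pi)) * lam l) > 0}"
    proof
      fix l assume l: "l \<in> {1..i} \<union> {j..m}"
      have "cos (a l - (t - pi)) > 0"
      proof (cases "l \<le> i")
        case True
        hence "a l \<le> a i" using l ij by (auto intro: le)
        thus ?thesis using gt bd[of l] bd[of i] bd[of j] unfolding t_def 
          by (intro cos_gt_zero_pi) (simp_all add: field_simps)
      next
        case False
        hence "a j \<le> a l" using l ij by (auto intro: le)
        \<comment> \<open>The indices from \<open>j\<close> on lie in the half-plane centred at
          \<open>t - pi\<close> only after a full turn.\<close>
        have "cos (a l - (t - pi) - 2 * pi) > 0"
          using \<open>a j \<le> a l\<close> gt bd[of l] bd[of i] bd[of j] unfolding t_def 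
          by (intro cos_gt_zero_pi) (simp_all add: field_simps)
        thus ?thesis by (simp add: cos_diff)
      qed
      moreover have "lam l \<noteq> 0" using nz l ij by auto
      ultimately show "l \<in> {l \<in> {1..m}. Re (cis (- (t - pi)) * lam l) > 0}"
        using l ij unfolding Re_cis_mult a_def by auto
    qed
    hence "card ({1..i} \<union> {j..m}) \<le> card {l \<in> {1..m}. Re (cis (- (t - pi)) * lam l) > 0}" 
      by (intro card_mono) auto
    moreover have "card ({1..i} \<union> {j..m}) = i + (m + 1 - j)"
      using ij \<open>i \<noteq> j\<close> by (subst card_Un_disjoint) auto
    ultimately show False using half[of "cis (- (t - pi))"] q ij by simp
  qed
qed

lemma isotropic_dim_odd_angles:
  assumes nz: "\<And>j. 1 \<le> j \<Longrightarrow> j \<le> 2 * p + 1 \<Longrightarrow> lam j \<noteq> 0"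
    and mono: "\<And>i j. 1 \<le> i \<Longrightarrow> i \<le> j \<Longrightarrow> j \<le> 2 * p + 1 \<Longrightarrow> Arg2pi (lam i) \<le> Arg2pi (lam j)"
    and le: "\<And>j. 1 \<le> j \<Longrightarrow> j \<le> p + 1 \<Longrightarrow> Arg2pi (lam (j + p)) - Arg2pi (lam j) \<le> pi"
    and ge: "\<And>j. 1 \<le> j \<Longrightarrow> j \<le> p \<Longrightarrow> Arg2pi (lam (j + p + 1)) - Arg2pi (lam j) \<ge> pi"
  shows "isotropic_dim {1..2 * p + 1} lam p"
proof (rule isotropic_dim_odd)
  fix i assume i: "i \<in> {1..2 * p + 1}"
  have "{j \<in> {1..2 * p + 1}. ccw (lam i) (lam j)} = {l \<in> {1..2 * p + 1}. 
      0 \<le> Arg2pi (lam l) - Arg2pi (lam i) \<and> Arg2pi (lam l) - Arg2pi (lam i) < pi \<or> 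
      Arg2pi (lam l) - Arg2pi (lam i) < - pi}"
    using ccw_cw_Arg2pi(1)[OF nz nz] i by (intro Collect_cong) auto
  thus "card {j \<in> {1..2 * p + 1}. ccw (lam i) (lam j)} \<le> p + 1"
    using card_angles_ahead[of p "\<lambda>l. Arg2pi (lam l)" i] mono le ge i by simp
  have "{j \<in> {1..2 * p + 1}. cw (lam i) (lam j)} = {l \<in> {1..2 * p + 1}. 
      - pi < Arg2pi (lam l) - Arg2pi (lam i) \<and> Arg2pi (lam l) - Arg2pi (lam i) \<le> 0 \<or> 
      Arg2pi (lam l) - Arg2pi (lam i) > pi}"
    using ccw_cw_Arg2pi(2)[OF nz nz] i by (intro Collect_cong) auto
  thus "card {j \<in> {1..2 * p + 1}. cw (lam i) (lam j)} \<le> p + 1"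
    using card_angles_behind[of p "\<lambda>l. Arg2pi (lam l)" i] mono le ge i by simp
qed (use nz in auto)

text \<open>The eigenvalues at \<open>j\<close> and \<open>j + p\<close> point in opposite
  directions, so weighting each by the modulus of the other makes them cancel; the \<open>p\<close>
  pairs are disjoint.\<close>

lemma isotropic_dim_even_angles:
  assumes nz: "\<And>j. 1 \<le> j \<Longrightarrow> j \<le> 2 * p \<Longrightarrow> lam j \<noteq> 0"
    and opp: "\<And>j. 1 \<le> j \<Longrightarrow> j \<le> p \<Longrightarrow> Arg2pi (lam (j + p)) - Arg2pi (lam j) = pi"
  shows "isotropic_dim {1..2 * p} lam p"
proof -
  have "isotropic_dim (\<Union>j\<in>{1..q}. {j, j + p}) lam q" if "q \<le> p" for q
    using that
  proof (induction q)
    case (Suc q)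
    define z w where "z = lam (Suc q)" and "w = lam (Suc q + p)"
    have "Arg2pi w = Arg2pi z + pi" using opp[of "Suc q"] Suc.prems unfolding z_def w_def by simp
    hence w: "w = - of_real (cmod w) * cis (Arg2pi z)"
      using polar_Arg2pi[of w] by (simp flip: cis_mult)
    have "of_real (cmod w) * z + of_real (cmod z) * w = 0"
    proof -
      have "of_real (cmod w) * z + of_real (cmod z) * w = of_real (cmod w) * (of_real (cmod z) * cis (Arg2pi z))
        + of_real (cmod z) * (- of_real (cmod w) * cis (Arg2pi z))"
        by (rule arg_cong2[of _ _ _ _ "(+)"]) (metis polar_Arg2pi, metis w)
      thus ?thesis by simp
    qed
    moreover have "cmod w > 0" using nz[of "Suc q + p"] Suc.prems unfolding w_def by auto
    ultimately have "isotropic_dim {Suc q, Suc q + p} lam 1"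
      using Suc.prems by (intro isotropic_dim_weights[of _ "Suc q" "\<lambda>j. if j = Suc q then cmod w else cmod z"])
        (auto simp: z_def w_def)
    moreover have "isotropic_dim (\<Union>j\<in>{1..q}. {j, j + p}) lam q" using Suc by simp
    ultimately have "isotropic_dim ((\<Union>j\<in>{1..q}. {j, j + p}) \<union> {Suc q, Suc q + p}) lam (q + 1)"
      using Suc.prems by (intro isotropic_dim_union) auto
    moreover have "(\<Union>j\<in>{1..q}. {j, j + p}) \<union> {Suc q, Suc q + p} = (\<Union>j\<in>{1..Suc q}. {j, j + p})"
      by (auto simp: atLeastAtMostSuc_conv)
    ultimately show ?case by simp
  qed (simp add: isotropic_dim_0)
  from this[of p] show ?thesis by (rule isotropic_dim_superset) auto
qed

section \<open>The zero-dilation index of a normal matrix\<close>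

text \<open>Seen as a Jordan matrix with blocks of size 1, a diagonal matrix has its kernel
  dimension given by the formula for generalized eigenspaces.\<close>

lemma mat_diag_eq_jordan_matrix:
  "mat_diag (length es) (\<lambda>i. es ! i) = jordan_matrix (map (Pair 1) es)"
proof (induction es)
  case Nil
  show ?case by (auto simp: jordan_matrix_def mat_diag_def)
next
  case (Cons e es)
  let ?D = "mat_diag (length es) (\<lambda>i. es ! i)"
  have "jordan_matrix (map (Pair 1) (e # es))
    = four_block_mat (jordan_block 1 e) (0\<^sub>m 1 (length es)) (0\<^sub>m (length es) 1) ?D"
  proof -
    have "dim_row ?D = length es" "dim_col ?D = length es" by (simp_all add: mat_diag_def)
    hence dim: "dim_row (jordan_matrix (map (Pair 1) es)) = length es" 
      "dim_col (jordan_matrix (map (Pair 1) es)) = length es" by (simp_all only: Cons.IH)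
    show ?thesis
      using dim unfolding Cons.IH unfolding jordan_matrix_def by (simp add: Let_def)
  qed
  also have "\<dots> = mat_diag (length (e # es)) (\<lambda>i. (e # es) ! i)"
    by (rule eq_matI) (auto simp: mat_diag_def)
  finally show ?case by simp
qed

lemma kernel_dim_of_diagonalization:
  fixes A :: "complex mat"
  assumes A: "A \<in> carrier_mat n n" and sim: "similar_mat A (mat_diag (length es) (\<lambda>i. es ! i))"
  shows "kernel_dim A = length (filter (\<lambda>e. e = 0) es)"
proof -
  have "char_matrix A 0 = A" unfolding char_matrix_def using A by (intro eq_matI) auto
  hence "kernel_dim A = dim_gen_eigenspace A 0 1"
    unfolding dim_gen_eigenspace_def using A by simp
  also have "\<dots> = dim_gen_eigenspace (jordan_matrix (map (Pair 1) es)) 0 1"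
    using dim_gen_eigenspace_similar[OF sim] unfolding mat_diag_eq_jordan_matrix by simp
  also have "\<dots> = length (filter (\<lambda>e. e = 0) es)"
    unfolding dim_gen_eigenspace_jordan_matrix by (induction es) auto
  finally show ?thesis .
qed

lemma proots_linear_factors:
  "proots (\<Prod>e\<leftarrow>es. [:- e, 1:]) = mset (es :: 'a :: idom list)"
proof (induction es)
  case (Cons e es)
  have "(\<Prod>e\<leftarrow>es. [:- e, 1:]) \<noteq> 0" by (auto simp: prod_list_zero_iff)
  thus ?case using Cons proots_mult[of "[:- e, 1:]"] by (simp del: mult_pCons_left)
qed simp

text \<open>The list may enumerate the characteristic roots in any order. It is applied both to an
  arbitrary list, which counts the zeros, and to one adapted to \<open>lam\<close>.\<close>

lemma normal_mat_diagonalized: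
  assumes A: "A \<in> carrier_mat n n" "normal_mat A" and es: "mset es = proots (char_poly A)"
  shows "length es = n" "is_zero_dilation A r \<longleftrightarrow> is_zero_dilation (mat_diag n (\<lambda>i. es ! i)) r"
    "kernel_dim A = length (filter (\<lambda>e. e = 0) es)"
proof -
  obtain es' where es': "char_poly A = (\<Prod>e\<leftarrow>es'. [:- e, 1:])" "length es' = n"
    using char_poly_factorized[OF A(1)] by auto
  have perm: "mset es = mset es'" unfolding es es'(1) by (rule proots_linear_factors)
  show len: "length es = n" using es'(2) mset_eq_length[OF perm] by simp
  have cp: "char_poly A = (\<Prod>e\<leftarrow>es. [:- e, 1:])"
    unfolding es' using perm by (metis mset_map prod_mset_prod_list)
  from normal_mat_unitary_diagonalization[OF A cp] obtain U where 
    U: "U \<in> carrier_mat n n" "mat_adjoint U * U = 1\<^sub>m n" 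
      "mat_adjoint U * A * U = mat_diag n (\<lambda>i. es ! i)" by auto
  show "is_zero_dilation A r \<longleftrightarrow> is_zero_dilation (mat_diag n (\<lambda>i. es ! i)) r"
    using is_zero_dilation_unitary_iff[OF A(1) U(1,2)] unfolding U(3) by simp
  have "similar_mat_wit (mat_diag n (\<lambda>i. es ! i)) A (mat_adjoint U) U"
    by (rule similar_mat_witI[of _ _ n]) (use A U unitary_inverse[OF U(1,2)] in simp_all)
  hence "similar_mat A (mat_diag n (\<lambda>i. es ! i))" 
    using similar_mat_sym unfolding similar_mat_def by blast
  thus "kernel_dim A = length (filter (\<lambda>e. e = 0) es)"
    using kernel_dim_of_diagonalization[OF A(1)] len by simp
qed

lemma isotropic_dim_shift:
  assumes "isotropic_dim {1..m} lam r" "\<And>i. i < m \<Longrightarrow> d i = lam (Suc i)"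
  shows "isotropic_dim {..<m} d r"
proof -
  from assms(1)[unfolded isotropic_dim_def] obtain f :: "nat \<Rightarrow> nat \<Rightarrow> complex" where 
    f: "\<forall>c. (\<forall>j\<in>{1..m}. (\<Sum>a<r. f a j * c a) = 0) \<longrightarrow> (\<forall>a<r. c a = 0)"
    and f0: "\<forall>a<r. \<forall>b<r. (\<Sum>j\<in>{1..m}. cnj (f a j) * lam j * f b j) = 0" by (elim exE conjE)
  have img: "{1..m} = Suc ` {..<m}" using image_Suc_lessThan by simp
  have sum: "(\<Sum>i<m. cnj (f a (Suc i)) * d i * f b (Suc i)) = (\<Sum>j\<in>{1..m}. cnj (f a j) * lam j * f b j)" for a b
    unfolding img by (subst sum.reindex) (auto simp: assms(2))
  show ?thesis
    unfolding isotropic_dim_def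
  proof (intro exI[of _ "\<lambda>a i. f a (Suc i)"] conjI allI impI)
    fix c a assume c: "\<forall>i\<in>{..<m}. (\<Sum>a<r. f a (Suc i) * c a) = 0" and "a < r"
    have "\<forall>j\<in>{1..m}. (\<Sum>a<r. f a j * c a) = 0" using c unfolding img by blast
    thus "c a = 0" using f \<open>a < r\<close> by blast
  next
    fix a b assume "a < r" "b < r"
    thus "(\<Sum>i<m. cnj (f a (Suc i)) * d i * f b (Suc i)) = 0" unfolding sum using f0 by simp
  qed
qed

text \<open>This replaces the matrix by the nonzero eigenvalues as points of the plane: from here
  on, lower bounds come from isotropic subspaces and upper bounds from half-planes.\<close>

lemma zero_dilation_index_bounds:
  assumes A: "A \<in> carrier_mat n n" "normal_mat A" and k: "k = kernel_dim A" "m = n - k"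
    and lam: "image_mset lam (mset_set {1..m}) = nonzero_eigenvalues A"
  shows "k + m = n" 
    and "\<And>j. 1 \<le> j \<Longrightarrow> j \<le> m \<Longrightarrow> lam j \<noteq> 0"
    and "\<And>r. isotropic_dim {1..m} lam r \<Longrightarrow> r + k \<le> zero_dilation_index A"
    and "\<And>c. card {j \<in> {1..m}. Re (c * lam j) > 0} + zero_dilation_index A \<le> n"
proof -
  have "\<exists>es0. mset es0 = proots (char_poly A)" using ex_mset by blast
  then obtain es0 where es0: "mset es0 = proots (char_poly A)" by blast
  note es0_props = normal_mat_diagonalized[OF A es0]
  have "length (filter (\<lambda>e. e = 0) es0) = k" using es0_props(3) k by simp
  moreover from this have "k \<le> n" using es0_props(1) length_filter_le by metis
  ultimately show km: "k + m = n" using k by simp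
  \<comment> \<open>The nonzero eigenvalues come first in the order of \<open>lam\<close>, the zeros
    last. Positions count from 0, so position \<open>i < m\<close> carries
    \<open>lam (Suc i)\<close>.\<close>
  define es where "es = map lam [1..<m + 1] @ replicate k 0"
  have "mset (map lam [1..<m + 1]) = image_mset lam (mset_set {1..m})"
    by (simp add: atLeastLessThanSuc_atLeastAtMost del: upt_Suc)
  hence "mset es = {#z \<in># mset es0. z \<noteq> 0#} + replicate_mset k 0"
    unfolding es_def lam nonzero_eigenvalues_def es0 by simp
  also have "replicate_mset k 0 = {#z \<in># mset es0. z = 0#}"
    using \<open>length (filter (\<lambda>e. e = 0) es0) = k\<close> 
    by (metis filter_eq_replicate_mset size_mset mset_filter size_replicate_mset)
  also have "{#z \<in># mset es0. z \<noteq> 0#} + {#z \<in># mset es0. z = 0#} = mset es0"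
    using multiset_partition[of "mset es0" "\<lambda>z. z = 0"] by (simp add: union_commute)
  finally have es: "mset es = proots (char_poly A)" unfolding es0 .
  note es_props = normal_mat_diagonalized[OF A es]
  define d where "d i = es ! i" for i
  have d1: "d i = lam (Suc i)" if "i < m" for i
    using that unfolding d_def es_def by (simp add: nth_append del: upt_Suc)
  have d0: "d i = 0" if "m \<le> i" "i < n" for i
    using that km unfolding d_def es_def by (simp add: nth_append del: upt_Suc)
  have dil: "is_zero_dilation A r \<longleftrightarrow> is_zero_dilation (mat_diag n d) r" for r
    using es_props(2) unfolding d_def .
  show "lam j \<noteq> 0" if "1 \<le> j" "j \<le> m" for j
  proof -
    have "lam j \<in># image_mset lam (mset_set {1..m})" using that by simp
    thus ?thesis unfolding lam nonzero_eigenvalues_def by simp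
  qed
  \<comment> \<open>The constant \<open>c = 0\<close> empties the half-plane and leaves a bound on
    the size of a dilation, which \<open>GREATEST\<close> requires.\<close>
  have le_n: "r \<le> n" if "is_zero_dilation A r" for r
    using zero_dilation_halfplane[of n d r 0] that unfolding dil by simp
  show lower: "r + k \<le> zero_dilation_index A" if r: "isotropic_dim {1..m} lam r" for r
  proof -
    have "isotropic_dim ({..<m} \<union> {m..<n}) d (r + card {m..<n})"
      using isotropic_dim_shift[OF r] d1 d0 by (intro isotropic_dim_union isotropic_dim_zeros) auto
    moreover have "{..<m} \<union> {m..<n} = {..<n}" "card {m..<n} = k" using km by auto
    ultimately have "is_zero_dilation A (r + k)" unfolding dil 
      by (simp add: isotropic_dim_imp_zero_dilation)
    show ?thesis
    proof (cases "r + k = 0")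
      case False
      hence ex: "1 \<le> r + k \<and> is_zero_dilation A (r + k)" using \<open>is_zero_dilation A (r + k)\<close> by linarith
      have "r + k \<le> (GREATEST k. 1 \<le> k \<and> is_zero_dilation A k)"
        using ex le_n by (intro Greatest_le_nat[of "\<lambda>k. 1 \<le> k \<and> is_zero_dilation A k" _ n]) blast+
      thus ?thesis using ex unfolding zero_dilation_index_def by auto
    qed simp
  qed
  \<comment> \<open>The index is attained in its default case as well, because a dilation of size 0
    always exists.\<close>
  have index: "is_zero_dilation A (zero_dilation_index A)"
  proof (cases "\<exists>k\<ge>1. is_zero_dilation A k")
    case True
    then obtain k' where k': "1 \<le> k' \<and> is_zero_dilation A k'" by blast
    have "1 \<le> (GREATEST k. 1 \<le> k \<and> is_zero_dilation A k) \<and> 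
        is_zero_dilation A (GREATEST k. 1 \<le> k \<and> is_zero_dilation A k)"
      using k' le_n by (intro GreatestI_nat[of "\<lambda>k. 1 \<le> k \<and> is_zero_dilation A k" k' n]) blast+
    thus ?thesis using True unfolding zero_dilation_index_def by auto
  next
    case False
    hence "zero_dilation_index A = 0" unfolding zero_dilation_index_def by auto
    thus ?thesis unfolding dil by (simp add: isotropic_dim_imp_zero_dilation isotropic_dim_0)
  qed
  show "card {j \<in> {1..m}. Re (c * lam j) > 0} + zero_dilation_index A \<le> n" for c
  proof -
    have "{j \<in> {1..m}. Re (c * lam j) > 0} \<subseteq> Suc ` {i \<in> {..<n}. Re (c * d i) > 0}"
    proof
      fix j assume j: "j \<in> {j \<in> {1..m}. Re (c * lam j) > 0}"
      hence "d (j - 1) = lam j" using d1[of "j - 1"] by auto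
      hence "j - 1 \<in> {i \<in> {..<n}. Re (c * d i) > 0}" "j = Suc (j - 1)" using j km by auto
      thus "j \<in> Suc ` {i \<in> {..<n}. Re (c * d i) > 0}" by blast
    qed
    hence "card {j \<in> {1..m}. Re (c * lam j) > 0} \<le> card (Suc ` {i \<in> {..<n}. Re (c * d i) > 0})"
      by (intro card_mono) auto
    also have "\<dots> \<le> card {i \<in> {..<n}. Re (c * d i) > 0}" by (rule card_image_le) simp
    finally show ?thesis using zero_dilation_halfplane[of n d "zero_dilation_index A" c] index 
      unfolding dil by simp
  qed
qed

text \<open>\<open>Re (Complex 1 t * z) = Re z - t * Im z\<close> vanishes for at most one
  \<open>t\<close> if \<open>z\<close> is nonzero, so all but finitely many \<open>t\<close> work.
  If \<open>Im z = 0\<close>, the quotient is 0 by convention and merely excludes one harmless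
  value.\<close>

lemma halfplane_avoiding:
  fixes lam :: "nat \<Rightarrow> complex"
  assumes "finite J" "\<And>j. j \<in> J \<Longrightarrow> lam j \<noteq> 0"
  shows "\<exists>c. \<forall>j\<in>J. Re (c * lam j) \<noteq> 0"
proof -
  obtain t where t: "t \<notin> (\<lambda>j. Re (lam j) / Im (lam j)) ` J"
    using ex_new_if_finite[OF infinite_UNIV_char_0] assms(1) by blast
  have "Re (Complex 1 t * lam j) \<noteq> 0" if "j \<in> J" for j
  proof
    assume "Re (Complex 1 t * lam j) = 0"
    hence eq: "Re (lam j) = t * Im (lam j)" by simp
    show False
    proof (cases "Im (lam j) = 0")
      case True
      thus False using eq assms(2)[OF that] by (simp add: complex_eq_iff)
    next
      case False
      hence "t = Re (lam j) / Im (lam j)" using eq by simp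
      thus False using t that by blast
    qed
  qed
  thus ?thesis by blast
qed

theorem theorem4p1:
  fixes A :: "complex mat" and n k :: nat
  assumes "A \<in> carrier_mat n n"
    and "normal_mat A"
    and "k = kernel_dim A"
  shows "k \<le> zero_dilation_index A \<and> zero_dilation_index A \<le> (n + k) div 2 \<and>
    (\<forall>lam :: nat \<Rightarrow> complex.
      image_mset lam (mset_set {1..n - k}) = nonzero_eigenvalues A \<longrightarrow>
      (\<forall>i j. 1 \<le> i \<and> i \<le> j \<and> j \<le> n - k \<longrightarrow> Arg2pi (lam i) \<le> Arg2pi (lam j)) \<longrightarrow>
        (zero_dilation_index A = k \<longleftrightarrow> 0 \<notin> convex hull (lam ` {1..n - k})) \<and>
        (even (n - k) \<longrightarrow>
          (zero_dilation_index A = (n + k) div 2 \<longleftrightarrow>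
            (\<forall>j. 1 \<le> j \<and> j \<le> (n - k) div 2 \<longrightarrow>
              Arg2pi (lam (j + (n - k) div 2)) - Arg2pi (lam j) = pi))) \<and>
        (odd (n - k) \<longrightarrow>
          (zero_dilation_index A = (n + k) div 2 \<longleftrightarrow>
            (\<forall>j. 1 \<le> j \<and> j \<le> (n - k + 1) div 2 \<longrightarrow>
              Arg2pi (lam (j + (n - k - 1) div 2)) - Arg2pi (lam j) \<le> pi) \<and>
            (\<forall>j. (n - k + 3) div 2 \<le> j \<and> j \<le> n - k \<longrightarrow>
              Arg2pi (lam (j - (n - k + 1) div 2)) - Arg2pi (lam j) \<le> - pi))))"
proof -
  define m where "m = n - k"
  note bounds = zero_dilation_index_bounds[OF assms m_def]
  have index_le: "zero_dilation_index A \<le> (n + k) div 2" and index_ge: "k \<le> zero_dilation_index A"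
  proof -
    obtain es where es: "mset es = proots (char_poly A)" using ex_mset by blast
    \<comment> \<open>The general bounds mention no enumeration of the nonzero eigenvalues, so one
      is built here. It starts at 1, hence the shift in \<open>lam\<close>.\<close>
    define ns where "ns = filter (\<lambda>e. e \<noteq> 0) es"
    define lam where "lam j = ns ! (j - 1)" for j
    have "length ns + kernel_dim A = n"
      using normal_mat_diagonalized[OF assms(1,2) es] sum_length_filter_compl[of "\<lambda>e. e \<noteq> 0" es] 
      unfolding ns_def by simp
    hence len: "length ns = m" using assms(3) unfolding m_def by simp
    have "map lam [1..<m + 1] = ns" 
      by (rule nth_equalityI) (auto simp: lam_def len simp del: upt_Suc)
    moreover have "mset (map lam [1..<m + 1]) = image_mset lam (mset_set {1..m})"
      by (simp add: atLeastLessThanSuc_atLeastAtMost del: upt_Suc)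
    ultimately have lam: "image_mset lam (mset_set {1..m}) = nonzero_eigenvalues A"
      unfolding nonzero_eigenvalues_def es[symmetric] ns_def by (metis mset_filter)
    note b = bounds[OF lam]
    show "k \<le> zero_dilation_index A" using b(3)[OF isotropic_dim_0] by simp
    have "\<exists>c. \<forall>j\<in>{1..m}. Re (c * lam j) \<noteq> 0"
      by (rule halfplane_avoiding) (use b(2) in auto)
    then obtain c where c: "\<forall>j\<in>{1..m}. Re (c * lam j) \<noteq> 0" by blast
    \<comment> \<open>No nonzero eigenvalue lies on the common boundary line, so the two open
      half-planes contain all \<open>m\<close> of them. Adding both bounds for the index
      \<open>d\<close> gives \<open>m + 2 * d \<le> 2 * n\<close>, that is,
      \<open>2 * d \<le> n + k\<close>.\<close>
    have "{1..m} = {j \<in> {1..m}. Re (c * lam j) > 0} \<union> {j \<in> {1..m}. Re (- c * lam j) > 0}"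
      using c by (force simp del: times_complex.sel)
    hence "m \<le> card {j \<in> {1..m}. Re (c * lam j) > 0} + card {j \<in> {1..m}. Re (- c * lam j) > 0}"
      using card_Un_le by (metis card_atLeastAtMost diff_Suc_1)
    with b(1) b(4)[of c] b(4)[of "- c"] show "zero_dilation_index A \<le> (n + k) div 2" by linarith
  qed
  have main: "(zero_dilation_index A = k \<longleftrightarrow> 0 \<notin> convex hull (lam ` {1..m}))"
    "even m \<Longrightarrow> zero_dilation_index A = (n + k) div 2 \<longleftrightarrow>
            (\<forall>j. 1 \<le> j \<and> j \<le> m div 2 \<longrightarrow>
              Arg2pi (lam (j + m div 2)) - Arg2pi (lam j) = pi)"
    "odd m \<Longrightarrow> zero_dilation_index A = (n + k) div 2 \<longleftrightarrow>
            (\<forall>j. 1 \<le> j \<and> j \<le> (m + 1) div 2 \<longrightarrow>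
              Arg2pi (lam (j + (m - 1) div 2)) - Arg2pi (lam j) \<le> pi) \<and>
            (\<forall>j. (m + 3) div 2 \<le> j \<and> j \<le> m \<longrightarrow>
              Arg2pi (lam (j - (m + 1) div 2)) - Arg2pi (lam j) \<le> - pi)"
    if lam: "image_mset lam (mset_set {1..m}) = nonzero_eigenvalues A"
      and mono: "\<forall>i j. 1 \<le> i \<and> i \<le> j \<and> j \<le> m \<longrightarrow> Arg2pi (lam i) \<le> Arg2pi (lam j)" 
    for lam :: "nat \<Rightarrow> complex"
  proof -
    note b = bounds[OF lam]
    have mono': "Arg2pi (lam i) \<le> Arg2pi (lam j)" if "1 \<le> i" "i \<le> j" "j \<le> m" for i j
      using mono that by blast
    show "zero_dilation_index A = k \<longleftrightarrow> 0 \<notin> convex hull (lam ` {1..m})"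
    proof
      assume eq: "zero_dilation_index A = k"
      show "0 \<notin> convex hull (lam ` {1..m})"
      proof
        assume "0 \<in> convex hull (lam ` {1..m})"
        hence "isotropic_dim {1..m} lam 1" by (intro isotropic_dim_convex_hull) auto
        thus False using b(3) eq by fastforce
      qed
    next
      assume "0 \<notin> convex hull (lam ` {1..m})"
      moreover have "closed (convex hull (lam ` {1..m}))" 
        by (intro compact_imp_closed finite_imp_compact_convex_hull) simp
      \<comment> \<open>As \<open>inner a x = Re (cnj a * x)\<close>, separation of the hull from 0
        puts all \<open>m\<close> nonzero eigenvalues into one open half-plane, and the index is at
        most \<open>n - m = k\<close>.\<close>
      ultimately obtain a b where ab: "0 < b" "\<And>x. x \<in> convex hull (lam ` {1..m}) \<Longrightarrow> inner a x > b"
        using separating_hyperplane_closed_0[of "convex hull (lam ` {1..m})"] by (auto simp: convex_convex_hull)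
      have "Re (cnj a * lam j) > 0" if "j \<in> {1..m}" for j
      proof -
        have "lam j \<in> convex hull (lam ` {1..m})" using that by (intro hull_inc) auto
        hence "inner a (lam j) > 0" using ab by force
        thus ?thesis by (simp add: inner_complex_def)
      qed
      hence "{j \<in> {1..m}. Re (cnj a * lam j) > 0} = {1..m}" by blast
      hence "m + zero_dilation_index A \<le> n" using b(4)[of "cnj a"] by simp
      thus "zero_dilation_index A = k" using index_ge b(1) by simp
    qed
    have half: "card {j \<in> {1..m}. Re (c * lam j) > 0} \<le> q" 
      if "n = q + zero_dilation_index A" for c q
      using b(4)[of c] that by simp
    show "zero_dilation_index A = (n + k) div 2 \<longleftrightarrow>
      (\<forall>j. 1 \<le> j \<and> j \<le> m div 2 \<longrightarrow> Arg2pi (lam (j + m div 2)) - Arg2pi (lam j) = pi)"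
      if "even m"
    proof -
      from that obtain p where p: "m = 2 * p" by (elim evenE)
      have nk: "(n + k) div 2 = p + k" using b(1) p by simp
      show ?thesis
      proof
        assume "zero_dilation_index A = (n + k) div 2"
        hence "n = p + zero_dilation_index A" using nk b(1) p by simp
        \<comment> \<open>With \<open>q = p\<close> and \<open>m = 2 * p\<close>, indices at
          distance \<open>p\<close> satisfy both gap bounds, hence equality.\<close>
        note gaps = angle_gaps_of_halfplanes[of m lam, OF b(2) mono' half[OF this]]
        show "\<forall>j. 1 \<le> j \<and> j \<le> m div 2 \<longrightarrow> Arg2pi (lam (j + m div 2)) - Arg2pi (lam j) = pi"
        proof (intro allI impI)
          fix j assume "1 \<le> j \<and> j \<le> m div 2"
          thus "Arg2pi (lam (j + m div 2)) - Arg2pi (lam j) = pi"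
            using gaps[of j "j + p"] p by (intro antisym) auto
        qed
      next
        assume opp: "\<forall>j. 1 \<le> j \<and> j \<le> m div 2 \<longrightarrow> Arg2pi (lam (j + m div 2)) - Arg2pi (lam j) = pi"
        have "isotropic_dim {1..2 * p} lam p"
          using b(2) opp p by (intro isotropic_dim_even_angles) auto
        hence "p + k \<le> zero_dilation_index A" using b(3) p by simp
        thus "zero_dilation_index A = (n + k) div 2" using index_le nk by simp
      qed
    qed
    show "zero_dilation_index A = (n + k) div 2 \<longleftrightarrow>
            (\<forall>j. 1 \<le> j \<and> j \<le> (m + 1) div 2 \<longrightarrow>
              Arg2pi (lam (j + (m - 1) div 2)) - Arg2pi (lam j) \<le> pi) \<and>
            (\<forall>j. (m + 3) div 2 \<le> j \<and> j \<le> m \<longrightarrow>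
              Arg2pi (lam (j - (m + 1) div 2)) - Arg2pi (lam j) \<le> - pi)"
      if "odd m"
    proof -
      from that obtain p where p: "m = 2 * p + 1" by (elim oddE)
      have nk: "(n + k) div 2 = p + k" using b(1) p by simp
      have div: "(m + 1) div 2 = p + 1" "(m - 1) div 2 = p" "(m + 3) div 2 = p + 2" using p by simp_all
      show ?thesis unfolding div
      proof
        assume "zero_dilation_index A = (n + k) div 2"
        hence "n = (p + 1) + zero_dilation_index A" using nk b(1) p by simp
        \<comment> \<open>With \<open>q = p + 1\<close> and \<open>m = 2 * p + 1\<close>, the upper
          bound applies at distance \<open>p\<close> and the lower one at distance
          \<open>p + 1\<close>.\<close>
        note gaps = angle_gaps_of_halfplanes[of m lam, OF b(2) mono' half[OF this]]
        show "(\<forall>j. 1 \<le> j \<and> j \<le> p + 1 \<longrightarrow> Arg2pi (lam (j + p)) - Arg2pi (lam j) \<le> pi) \<and>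
          (\<forall>j. p + 2 \<le> j \<and> j \<le> m \<longrightarrow> Arg2pi (lam (j - (p + 1))) - Arg2pi (lam j) \<le> - pi)"
        proof (intro conjI allI impI)
          fix j assume "1 \<le> j \<and> j \<le> p + 1"
          thus "Arg2pi (lam (j + p)) - Arg2pi (lam j) \<le> pi" using gaps(2)[of j "j + p"] p by auto
        next
          fix j assume j: "p + 2 \<le> j \<and> j \<le> m"
          hence "Arg2pi (lam j) - Arg2pi (lam (j - (p + 1))) \<ge> pi" 
            using gaps(1)[of "j - (p + 1)" j] p by auto
          thus "Arg2pi (lam (j - (p + 1))) - Arg2pi (lam j) \<le> - pi" by linarith
        qed
      next
        assume angles: "(\<forall>j. 1 \<le> j \<and> j \<le> p + 1 \<longrightarrow> Arg2pi (lam (j + p)) - Arg2pi (lam j) \<le> pi) \<and>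
          (\<forall>j. p + 2 \<le> j \<and> j \<le> m \<longrightarrow> Arg2pi (lam (j - (p + 1))) - Arg2pi (lam j) \<le> - pi)"
        have ge: "Arg2pi (lam (j + p + 1)) - Arg2pi (lam j) \<ge> pi" if j: "1 \<le> j" "j \<le> p" for j
        proof -
          have "Arg2pi (lam (j + p + 1 - (p + 1))) - Arg2pi (lam (j + p + 1)) \<le> - pi"
            using angles j p by (intro angles[THEN conjunct2, rule_format]) auto
          thus ?thesis by simp
        qed
        have "isotropic_dim {1..2 * p + 1} lam p"
          using b(2) mono' angles ge p by (intro isotropic_dim_odd_angles) auto
        hence "p + k \<le> zero_dilation_index A" using b(3) p by simp
        thus "zero_dilation_index A = (n + k) div 2" using index_le nk by simp
      qed
    qed
  qed
  show ?thesis unfolding m_def[symmetric] 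
    by (intro conjI allI impI index_ge index_le main) blast+
qed

end
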